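(* Let $d\ge 1$ and let $G$ be a graph with $n\ge d+2$ vertices. The set of Fstressable frameworks of $G$ in $\mathbb{R}^d$, viewed as a subset of $(\mathbb{R}^d)^n=\mathbb{R}^{dn}$, is a constructible set. It is irreducible and has the same dimension as the set of Gstressable frameworks of $G$ in $\mathbb{R}^d$.
   Context: Graphs are finite and simple, with vertex set $\{1,\dots,n\}$. A framework $(G,p)$ in $\mathbb{R}^d$ is the graph $G$ with a configuration $p=(p_1,\dots,p_n)$ of points of $\mathbb{R}^d$. The configuration $p$ is in affine general position if no $k\le d+1$ of its points lie on a $(k-2)$-dimensional affine subspace. An equilibrium stress matrix of $(G,p)$ is a real symmetric $n\times n$ matrix $\Omega$ with $\Omega_{ij}=0$ whenever $i\neq j$ and $\{i,j\}$ is not an edge, with the all-ones vector in its kernel, and with $\sum_j\Omega_{ij}p_j=0$ for all $i$. $(G,p)$ is Gstressable if $p$ is in affine general position and $(G,p)$ has an equilibrium stress matrix of rank $n-d-1$. $(G,p)$ is Fstressable if $(G,p)$ has an equilibrium stress matrix of rank $n-d-1$ and, for each vertex $i$, the points $p_i$ and $p_j$ ($j$ ranging over the neighbors of $i$) together have a full $d$-dimensional affine span. Algebraic sets in $\mathbb{R}^N$ are common zero sets of finitely many polynomials; a quasi-projective variety is an algebraic set minus an algebraic set; a constructible set is a finite union of quasi-projective varieties. An algebraic set is irreducible if it is not the union of two proper algebraic subsets (with this convention the empty set, which may occur here, is irreducible); a semi-algebraic (in particular constructible) set is irreducible if its Zariski closure is. The dimension of a real semi-algebraic set is the largest $t$ such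 that some Euclidean-open subset of it is a smooth $t$-dimensional submanifold. *)

theory Defs
  imports "HOL-Analysis.Analysis"
begin

section \<open>Algebraic and constructible sets\<close>

definition algebraic_set :: "'a::euclidean_space set \<Rightarrow> bool" where
  "algebraic_set S \<longleftrightarrow>
     (\<exists>F. finite F \<and> (\<forall>f\<in>F. real_polynomial_function f) \<and> S = {x. \<forall>f\<in>F. f x = 0})"

definition quasi_projective :: "'a::euclidean_space set \<Rightarrow> bool" where
  "quasi_projective S \<longleftrightarrow> (\<exists>A B. algebraic_set A \<and> algebraic_set B \<and> S = A - B)"

definition constructible_set :: "'a::euclidean_space set \<Rightarrow> bool" where
  "constructible_set S \<longleftrightarrow> (\<exists>\<V>. finite \<V> \<and> (\<forall>V\<in>\<V>. quasi_projective V) \<and> S = \<Union>\<V>)"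

definition zariski_closure :: "'a::euclidean_space set \<Rightarrow> 'a set" where
  "zariski_closure S = algebraic_set hull S"

text \<open>To be used for algebraic sets only. By this definition the empty set is irreducible.\<close>

definition irreducible_algebraic_set :: "'a::euclidean_space set \<Rightarrow> bool" where
  "irreducible_algebraic_set A \<longleftrightarrow>
     \<not> (\<exists>B C. algebraic_set B \<and> algebraic_set C \<and> B \<subset> A \<and> C \<subset> A \<and> A = B \<union> C)"

definition irreducible_set :: "'a::euclidean_space set \<Rightarrow> bool" where
  "irreducible_set S \<longleftrightarrow> irreducible_algebraic_set (zariski_closure S)"

section \<open>Smooth submanifolds and dimension\<close>

text \<open>\<open>Ck_on k S f\<close> says that \<open>f\<close> is \<open>k\<close> times continuously differentiable on \<open>S\<close>. It is meant
  for open \<open>S\<close>, since derivatives are taken in the full space.\<close>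

primrec Ck_on :: "nat \<Rightarrow> 'a::euclidean_space set \<Rightarrow> ('a \<Rightarrow> 'b::euclidean_space) \<Rightarrow> bool" where
  "Ck_on 0 S f \<longleftrightarrow> continuous_on S f"
| "Ck_on (Suc k) S f \<longleftrightarrow>
     (\<forall>x\<in>S. f differentiable (at x)) \<and> (\<forall>v. Ck_on k S (\<lambda>x. frechet_derivative f (at x) v))"

definition smooth_on :: "'a::euclidean_space set \<Rightarrow> ('a \<Rightarrow> 'b::euclidean_space) \<Rightarrow> bool" where
  "smooth_on S f \<longleftrightarrow> (\<forall>k. Ck_on k S f)"

definition diffeomorphism ::
    "'a::euclidean_space set \<Rightarrow> 'b::euclidean_space set \<Rightarrow> ('a \<Rightarrow> 'b) \<Rightarrow> ('b \<Rightarrow> 'a) \<Rightarrow> bool" where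
  "diffeomorphism U V f g \<longleftrightarrow>
     open U \<and> open V \<and> homeomorphism U V f g \<and> smooth_on U f \<and> smooth_on V g"

text \<open>Around each point, some diffeomorphism of open sets of the ambient space straightens \<open>M\<close>
  to a \<open>t\<close>-dimensional linear subspace.\<close>

definition smooth_submanifold :: "nat \<Rightarrow> 'a::euclidean_space set \<Rightarrow> bool" where
  "smooth_submanifold t M \<longleftrightarrow>
     (\<forall>x\<in>M. \<exists>(U::'a set) (V::'a set) f g L.
        x \<in> U \<and> diffeomorphism U V f g \<and> subspace L \<and> dim L = t \<and> f ` (U \<inter> M) = V \<inter> L)"

text \<open>To be used for semi-algebraic sets. Open subsets are taken nonempty, because the empty set is a
  submanifold of every dimension; the empty set gets dimension \<open>-1\<close>, as for \<open>aff_dim\<close>.\<close>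

definition semialgebraic_dim :: "'a::euclidean_space set \<Rightarrow> int" where
  "semialgebraic_dim S =
     (if S = {} then -1
      else int (GREATEST t. \<exists>U. U \<noteq> {} \<and> openin (top_of_set S) U \<and> smooth_submanifold t U))"

section \<open>Frameworks and stresses\<close>

text \<open>The vertex set is the finite type \<open>'n\<close>, so that \<open>n = CARD('n)\<close>; a graph is given by its set of
  edges. A configuration is a vector \<open>p :: real ^ 'd ^ 'n\<close>, where \<open>p $ i\<close> is the \<open>i\<close>-th point.\<close>

definition simple_graph :: "'n::finite set set \<Rightarrow> bool" where
  "simple_graph E \<longleftrightarrow> (\<forall>e\<in>E. card e = 2)"

text \<open>The quantification is over sets of vertices, not of points: coinciding points at distinct
  vertices are counted with multiplicity.\<close>

definition affine_general_position :: "real ^ 'd ^ 'n \<Rightarrow> bool" where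
  "affine_general_position p \<longleftrightarrow>
     (\<forall>K. card K \<le> CARD('d) + 1 \<longrightarrow>
        \<not> (\<exists>A. affine A \<and> aff_dim A = int (card K) - 2 \<and> (\<forall>i\<in>K. p $ i \<in> A)))"

definition equilibrium_stress_matrix ::
    "'n::finite set set \<Rightarrow> real ^ 'd ^ 'n \<Rightarrow> real ^ 'n ^ 'n \<Rightarrow> bool" where
  "equilibrium_stress_matrix E p \<Omega> \<longleftrightarrow>
     transpose \<Omega> = \<Omega> \<and>
     (\<forall>i j. i \<noteq> j \<and> {i, j} \<notin> E \<longrightarrow> \<Omega> $ i $ j = 0) \<and>
     \<Omega> *v vec 1 = 0 \<and>
     (\<forall>i. (\<Sum>j\<in>UNIV. (\<Omega> $ i $ j) *\<^sub>R (p $ j)) = 0)"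

text \<open>Rank \<open>n - d - 1\<close>, written without truncated subtraction.\<close>

definition has_max_rank_stress :: "'n::finite set set \<Rightarrow> real ^ 'd ^ 'n \<Rightarrow> bool" where
  "has_max_rank_stress E p \<longleftrightarrow>
     (\<exists>\<Omega>. equilibrium_stress_matrix E p \<Omega> \<and> rank \<Omega> + CARD('d) + 1 = CARD('n))"

definition Gstressable :: "'n::finite set set \<Rightarrow> real ^ 'd ^ 'n \<Rightarrow> bool" where
  "Gstressable E p \<longleftrightarrow> affine_general_position p \<and> has_max_rank_stress E p"

definition Fstressable :: "'n::finite set set \<Rightarrow> real ^ 'd ^ 'n \<Rightarrow> bool" where
  "Fstressable E p \<longleftrightarrow>
     has_max_rank_stress E p \<and>
     (\<forall>i. aff_dim (insert (p $ i) {p $ j | j. {i, j} \<in> E}) = int CARD('d))"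

end

theory Submission
  imports Defs "HOL-Computational_Algebra.Polynomial"
begin

text \<open>Write \<open>q\<^sub>i = (p\<^sub>i, 1)\<close>, so that an equilibrium stress of maximal rank is a symmetric matrix
  \<open>\<Omega>\<close> supported on the graph whose kernel consists exactly of the vectors \<open>(q\<^sub>i \<bullet> z)\<^sub>i\<close>. Factor
  \<open>\<Omega>\<^sub>i\<^sub>j = v\<^sub>i \<bullet> B v\<^sub>j\<close> with \<open>B\<close> symmetric of size \<open>n - d - 1\<close>. By Gale duality, the spanning condition
  at a vertex \<open>i\<close> says that the vectors \<open>B v\<^sub>j\<close>, \<open>j\<close> ranging over the non-neighbours of \<open>i\<close>, are linearly
  independent. Hence, as for orthogonal representations of graphs (Lovasz, Saks, Schrijver), the
  \<open>v\<^sub>i\<close> can be chosen one after the other, each from a space depending rationally on the earlier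
  choices. Interpolating linearly and projecting onto these spaces joins any two Fstressable
  frameworks by a rational curve along which all but finitely many points are Fstressable.
  Irreducibility follows at once. If there is an Fstressable framework, putting any \<open>n - d - 1\<close>
  vertices first in the order shows that every condition defining general position holds for some Fstressable framework, so
  by the rational curves the Gstressable frameworks form an open dense subset of the Fstressable
  ones; this gives equal dimensions without computing them. Constructibility holds because
  stresses are solutions of a linear system, which are polynomially parametrized on each stratum
  where a maximal independent set of equations is fixed.\<close>

section \<open>Linear independence and division-free Gram--Schmidt\<close>

text \<open>Stresses of maximal rank cannot simply be interpolated: a convex combination of two of
  them need not have rank \<open>n - d - 1\<close>, nor does it come with a configuration. In
  factored form the rank bound is automatic, and each condition
  \<open>v i \<bullet> (B *v v j) = 0\<close> is linear in whichever vector is chosen last.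
  Projecting onto the solutions of such conditions divides by a Gram determinant, which must not
  vanish at the prescribed frameworks; this is what local spanning provides. Indeed a relation with
  coefficients \<open>c\<close> among the \<open>B *v v j\<close> puts \<open>c\<close> into the
  kernel of the stress matrix, so \<open>c j = q j \<bullet> z\<close> for some \<open>z\<close>; if
  \<open>c\<close> is supported on \<open>T\<close>, then \<open>z\<close> is orthogonal to all
  \<open>q j\<close> with \<open>j\<close> outside \<open>T\<close>.

  The \<open>q i\<close> are recovered from the \<open>v i\<close> by one more projection. Their
  last coordinates may drift away from 1 and are normalised at the end. Every condition to be
  preserved is the nonvanishing of some rational function known to be nonzero at one time, so each
  costs only finitely many times.\<close>

definition lin_indep_on :: "('i \<Rightarrow> 'e::euclidean_space) \<Rightarrow> 'i set \<Rightarrow> bool" where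
  "lin_indep_on a T \<longleftrightarrow> inj_on a T \<and> independent (a ` T)"

lemma lin_indep_on_empty [simp]: "lin_indep_on a {}"
  by (simp add: lin_indep_on_def independent_empty)

lemma lin_indep_on_insert:
  assumes "k \<notin> T"
  shows "lin_indep_on a (insert k T) \<longleftrightarrow> lin_indep_on a T \<and> a k \<notin> span (a ` T)"
  using assms by (auto simp: lin_indep_on_def independent_insert span_base)

text \<open>Coefficients are indexed by \<open>T\<close> and not by its image, so equal vectors at
  different indices count as dependent. In this form a relation is a coefficient vector, which can
  be compared with kernel vectors of a stress matrix.\<close>

lemma lin_indep_on_iff:
  assumes "finite T"
  shows "lin_indep_on a T \<longleftrightarrow> (\<forall>c. (\<Sum>j\<in>T. c j *\<^sub>R a j) = 0 \<longrightarrow> (\<forall>j\<in>T. c j = 0))"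
  using assms
proof (induction T)
  case empty
  then show ?case by simp
next
  case (insert k T)
  have span: "a k \<in> span (a ` T) \<longleftrightarrow> (\<exists>c. a k = (\<Sum>j\<in>T. c j *\<^sub>R a j))" (is "?L \<longleftrightarrow> ?R")
  proof
    assume ?L
    then show ?R
    proof (rule span_induct)
      show "subspace {x. \<exists>c. x = (\<Sum>j\<in>T. c j *\<^sub>R a j)}"
        unfolding subspace_def
      proof (safe)
        show "\<exists>c. 0 = (\<Sum>j\<in>T. c j *\<^sub>R a j)" by (rule exI[of _ "\<lambda>_. 0"]) simp
      next
        fix c d :: "'a \<Rightarrow> real"
        show "\<exists>e. (\<Sum>j\<in>T. c j *\<^sub>R a j) + (\<Sum>j\<in>T. d j *\<^sub>R a j) = (\<Sum>j\<in>T. e j *\<^sub>R a j)"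
          by (rule exI[of _ "\<lambda>j. c j + d j"]) (simp add: scaleR_add_left sum.distrib)
      next
        fix r :: real and c :: "'a \<Rightarrow> real"
        show "\<exists>e. r *\<^sub>R (\<Sum>j\<in>T. c j *\<^sub>R a j) = (\<Sum>j\<in>T. e j *\<^sub>R a j)"
          by (rule exI[of _ "\<lambda>j. r * c j"]) (simp add: scaleR_sum_right)
      qed
    next
      fix x assume "x \<in> a ` T"
      then obtain j where j: "j \<in> T" "x = a j" by auto
      then show "\<exists>c. x = (\<Sum>j\<in>T. c j *\<^sub>R a j)"
        using insert.hyps(1)
        by (intro exI[of _ "\<lambda>i. if i = j then 1 else 0"]) (simp add: if_distrib[of "\<lambda>c. c *\<^sub>R _"] cong: if_cong)
    qed
  next
    assume ?R
    then obtain c where "a k = (\<Sum>j\<in>T. c j *\<^sub>R a j)" by blast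
    then show ?L by (simp only:) (intro span_sum span_scale span_base imageI)
  qed
  show ?case
  proof
    assume L: "lin_indep_on a (insert k T)"
    show "\<forall>c. (\<Sum>j\<in>insert k T. c j *\<^sub>R a j) = 0 \<longrightarrow> (\<forall>j\<in>insert k T. c j = 0)"
    proof (intro allI impI)
      fix c assume c: "(\<Sum>j\<in>insert k T. c j *\<^sub>R a j) = 0"
      then have c': "c k *\<^sub>R a k = - (\<Sum>j\<in>T. c j *\<^sub>R a j)"
        using insert.hyps by (simp add: eq_neg_iff_add_eq_0)
      have "c k = 0"
      proof (rule ccontr)
        assume "c k \<noteq> 0"
        then have "a k = (1 / c k) *\<^sub>R (c k *\<^sub>R a k)" by simp
        also have "\<dots> = (\<Sum>j\<in>T. (- c j / c k) *\<^sub>R a j)"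
          unfolding c' by (simp add: scaleR_sum_right sum_negf)
        finally have "\<exists>c. a k = (\<Sum>j\<in>T. c j *\<^sub>R a j)" by (rule exI[of _ "\<lambda>j. - c j / c k"])
        then have "a k \<in> span (a ` T)" by (simp only: span)
        then show False using L insert.hyps by (simp add: lin_indep_on_insert)
      qed
      with c' insert L show "\<forall>j\<in>insert k T. c j = 0"
        by (auto simp: lin_indep_on_insert)
    qed
  next
    assume R: "\<forall>c. (\<Sum>j\<in>insert k T. c j *\<^sub>R a j) = 0 \<longrightarrow> (\<forall>j\<in>insert k T. c j = 0)"
    have "lin_indep_on a T"
      unfolding insert.IH
    proof (intro allI impI)
      fix c assume c: "(\<Sum>j\<in>T. c j *\<^sub>R a j) = 0"
      have "(\<Sum>j\<in>insert k T. (c(k := 0)) j *\<^sub>R a j) = (\<Sum>j\<in>T. (c(k := 0)) j *\<^sub>R a j)"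
        using insert.hyps by simp
      also have "\<dots> = (\<Sum>j\<in>T. c j *\<^sub>R a j)"
        using insert.hyps by (intro sum.cong) auto
      finally have "\<forall>j\<in>insert k T. (c(k := 0)) j = 0" using R c by metis
      then show "\<forall>j\<in>T. c j = 0" using insert.hyps by (metis fun_upd_apply insertCI)
    qed
    moreover have "a k \<notin> span (a ` T)"
    proof
      assume "a k \<in> span (a ` T)"
      then obtain c where c: "a k = (\<Sum>j\<in>T. c j *\<^sub>R a j)" using span by blast
      have "(\<Sum>j\<in>insert k T. (c(k := -1)) j *\<^sub>R a j) = - a k + (\<Sum>j\<in>T. (c(k := -1)) j *\<^sub>R a j)"
        using insert.hyps by simp
      also have "(\<Sum>j\<in>T. (c(k := -1)) j *\<^sub>R a j) = (\<Sum>j\<in>T. c j *\<^sub>R a j)"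
        using insert.hyps by (intro sum.cong) auto
      finally have "\<forall>j\<in>insert k T. (c(k := -1)) j = 0" using R c by (metis add.left_inverse)
      then show False by simp
    qed
    ultimately show "lin_indep_on a (insert k T)" using insert.hyps by (simp add: lin_indep_on_insert)
  qed
qed

section \<open>Algebras of functions and vectors with coordinates in them\<close>

definition coords_in :: "('x \<Rightarrow> real) set \<Rightarrow> ('x \<Rightarrow> 'e::euclidean_space) \<Rightarrow> bool" where
  "coords_in \<A> f \<longleftrightarrow> (\<forall>b\<in>Basis. (\<lambda>x. f x \<bullet> b) \<in> \<A>)"

text \<open>Two instances are used: \<open>rat Z\<close>, rational functions of a time parameter,
  for the curves, and \<open>polys\<close>, polynomials on a Euclidean space, for constructibility.
  The second has no inverses, whence the division-free elimination below.\<close>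

locale function_algebra =
  fixes \<A> :: "('x \<Rightarrow> real) set"
  assumes const [intro]: "(\<lambda>_. c) \<in> \<A>"
    and add [intro]: "f \<in> \<A> \<Longrightarrow> g \<in> \<A> \<Longrightarrow> (\<lambda>x. f x + g x) \<in> \<A>"
    and mult [intro]: "f \<in> \<A> \<Longrightarrow> g \<in> \<A> \<Longrightarrow> (\<lambda>x. f x * g x) \<in> \<A>"
begin

lemma diff [intro]: "f \<in> \<A> \<Longrightarrow> g \<in> \<A> \<Longrightarrow> (\<lambda>x. f x - g x) \<in> \<A>"
  using add[OF _ mult[OF const[of "-1"]], of f g] by simp

lemma sum [intro]: "(\<And>i. i \<in> I \<Longrightarrow> f i \<in> \<A>) \<Longrightarrow> (\<lambda>x. \<Sum>i\<in>I. f i x) \<in> \<A>"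
  by (induction I rule: infinite_finite_induct) auto

lemma coords_inner_const [intro]:
  assumes "coords_in \<A> f" shows "(\<lambda>x. f x \<bullet> w) \<in> \<A>"
proof -
  have "(\<lambda>x. f x \<bullet> w) = (\<lambda>x. \<Sum>b\<in>Basis. (f x \<bullet> b) * (w \<bullet> b))"
    by (intro ext) (rule euclidean_inner)
  then show ?thesis using assms unfolding coords_in_def by (simp only:) (intro sum mult const; blast)
qed

lemma coords_inner [intro]:
  assumes "coords_in \<A> f" "coords_in \<A> g" shows "(\<lambda>x. f x \<bullet> g x) \<in> \<A>"
proof -
  have "(\<lambda>x. f x \<bullet> g x) = (\<lambda>x. \<Sum>b\<in>Basis. (f x \<bullet> b) * (g x \<bullet> b))"
    by (intro ext) (rule euclidean_inner)
  then show ?thesis using assms unfolding coords_in_def by (simp only:) (intro sum mult const; blast)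
qed

lemma coords_const [intro]: "coords_in \<A> (\<lambda>_. c)"
  by (auto simp: coords_in_def)

lemma coords_scaleR [intro]:
  "f \<in> \<A> \<Longrightarrow> coords_in \<A> g \<Longrightarrow> coords_in \<A> (\<lambda>x. f x *\<^sub>R g x)"
  by (auto simp: coords_in_def)

lemma coords_add [intro]:
  "coords_in \<A> f \<Longrightarrow> coords_in \<A> g \<Longrightarrow> coords_in \<A> (\<lambda>x. f x + g x)"
  by (auto simp: coords_in_def inner_add_left)

lemma coords_diff [intro]:
  "coords_in \<A> f \<Longrightarrow> coords_in \<A> g \<Longrightarrow> coords_in \<A> (\<lambda>x. f x - g x)"
  by (auto simp: coords_in_def inner_diff_left)

lemma coords_sum: "(\<And>i. i \<in> I \<Longrightarrow> coords_in \<A> (f i)) \<Longrightarrow> coords_in \<A> (\<lambda>x. \<Sum>i\<in>I. f i x)"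
  by (auto simp: coords_in_def inner_sum_left)

lemma polynomial:
  assumes "real_polynomial_function f" "coords_in \<A> c"
  shows "(\<lambda>t. f (c t)) \<in> \<A>"
  using assms(1)
proof induction
  case (linear f)
  have "f (c t) = c t \<bullet> adjoint f (1::real)" for t
    using adjoint_works[OF bounded_linear.linear[OF linear], of "c t" "1::real"] by simp
  then show ?case using assms(2) by (simp add: coords_inner_const)
qed auto

lemma coords_vecI:
  fixes f :: "'x \<Rightarrow> ('e::euclidean_space) ^ 'n"
  assumes "\<And>i. coords_in \<A> (\<lambda>x. f x $ i)"
  shows "coords_in \<A> f"
  using assms by (auto simp: coords_in_def Basis_vec_def inner_axis)

lemma coords_vec_nth:
  fixes f :: "'x \<Rightarrow> ('e::euclidean_space) ^ 'n"
  assumes "coords_in \<A> f"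
  shows "coords_in \<A> (\<lambda>x. f x $ i)"
  unfolding coords_in_def
proof
  fix b :: 'e assume "b \<in> Basis"
  have "(\<lambda>x. f x \<bullet> axis i b) \<in> \<A>" using assms by blast
  then show "(\<lambda>x. f x $ i \<bullet> b) \<in> \<A>" by (simp add: inner_axis)
qed

lemma coords_real_iff: "coords_in \<A> (f :: 'x \<Rightarrow> real) \<longleftrightarrow> f \<in> \<A>"
  by (auto simp: coords_in_def)

text \<open>Gram--Schmidt without divisions: \<open>G x\<close> is \<open>D x\<close> times the orthogonal projection onto the
  complement of the vectors \<open>a j x\<close>, where \<open>D x\<close> is up to positive factors their Gram
  determinant.\<close>

lemma gram_schmidt:
  fixes a :: "'i \<Rightarrow> 'x \<Rightarrow> 'e::euclidean_space"
  assumes "finite T" "\<And>j. j \<in> T \<Longrightarrow> coords_in \<A> (a j)"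
  obtains D G where "D \<in> \<A>" "\<forall>y. coords_in \<A> y \<longrightarrow> coords_in \<A> (\<lambda>x. G x (y x))"
    "\<forall>x. D x \<noteq> 0 \<longleftrightarrow> lin_indep_on (\<lambda>j. a j x) T"
    "\<forall>x y. \<forall>j\<in>T. a j x \<bullet> G x y = 0"
    "\<forall>x y. D x *\<^sub>R y - G x y \<in> span ((\<lambda>j. a j x) ` T)"
    "\<forall>x. linear (G x)"
proof -
  \<comment> \<open>The induction also carries \<open>G x y = 0\<close> wherever
    \<open>D x = 0\<close>. There one cannot divide by \<open>D x\<close> to express the new vector,
    and orthogonality to \<open>G' x y\<close> holds because that vector vanishes.\<close>
  have "\<exists>D G. D \<in> \<A> \<and> (\<forall>y. coords_in \<A> y \<longrightarrow> coords_in \<A> (\<lambda>x. G x (y x))) \<and>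
    (\<forall>x. (D x \<noteq> 0 \<longleftrightarrow> lin_indep_on (\<lambda>j. a j x) T) \<and> linear (G x) \<and> (D x = 0 \<longrightarrow> (\<forall>y. G x y = 0)) \<and>
      (\<forall>y. (\<forall>j\<in>T. a j x \<bullet> G x y = 0) \<and> D x *\<^sub>R y - G x y \<in> span ((\<lambda>j. a j x) ` T)))"
    using assms
  proof (induction T)
    case empty
    show ?case
      by (rule exI[of _ "\<lambda>_. 1"], rule exI[of _ "\<lambda>_ y. y"]) (auto simp: eta_contract_eq linear_ident)
  next
    case (insert k T)
    have "\<exists>D G. D \<in> \<A> \<and> (\<forall>y. coords_in \<A> y \<longrightarrow> coords_in \<A> (\<lambda>x. G x (y x))) \<and>
      (\<forall>x. (D x \<noteq> 0 \<longleftrightarrow> lin_indep_on (\<lambda>j. a j x) T) \<and> linear (G x) \<and> (D x = 0 \<longrightarrow> (\<forall>y. G x y = 0)) \<and>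
        (\<forall>y. (\<forall>j\<in>T. a j x \<bullet> G x y = 0) \<and> D x *\<^sub>R y - G x y \<in> span ((\<lambda>j. a j x) ` T)))"
      using insert.prems by (intro insert.IH) auto
    then obtain D G where DG: "D \<in> \<A> \<and> (\<forall>y. coords_in \<A> y \<longrightarrow> coords_in \<A> (\<lambda>x. G x (y x))) \<and>
      (\<forall>x. (D x \<noteq> 0 \<longleftrightarrow> lin_indep_on (\<lambda>j. a j x) T) \<and> linear (G x) \<and> (D x = 0 \<longrightarrow> (\<forall>y. G x y = 0)) \<and>
        (\<forall>y. (\<forall>j\<in>T. a j x \<bullet> G x y = 0) \<and> D x *\<^sub>R y - G x y \<in> span ((\<lambda>j. a j x) ` T)))"
      by (elim exE)
    then have DA: "D \<in> \<A>"
      and GA: "\<And>y. coords_in \<A> y \<Longrightarrow> coords_in \<A> (\<lambda>x. G x (y x))"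
      and D: "\<And>x. D x \<noteq> 0 \<longleftrightarrow> lin_indep_on (\<lambda>j. a j x) T"
      and lin: "\<And>x. linear (G x)" and G0: "\<And>x y. D x = 0 \<Longrightarrow> G x y = 0"
      and perp: "\<And>x y j. j \<in> T \<Longrightarrow> a j x \<bullet> G x y = 0"
      and spn: "\<And>x y. D x *\<^sub>R y - G x y \<in> span ((\<lambda>j. a j x) ` T)"
      by blast+
    \<comment> \<open>Where \<open>D x \<noteq> 0\<close>, \<open>r x\<close> is \<open>D x\<close>
      times the component of the new vector orthogonal to the old ones. \<open>G'\<close> removes
      the direction \<open>r x\<close> with the denominator \<open>r x \<bullet> r x\<close>
      cleared, and \<open>D'\<close> picks up this factor.\<close>
    define r where "r = (\<lambda>x. G x (a k x))"
    define D' where "D' = (\<lambda>x. D x * (r x \<bullet> r x))"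
    define G' where "G' = (\<lambda>x y. (r x \<bullet> r x) *\<^sub>R G x y - (G x y \<bullet> r x) *\<^sub>R r x)"
    have rA: "coords_in \<A> r" unfolding r_def using insert.prems by (intro GA) auto
    have perp_span: "w \<bullet> G x y = 0" if "w \<in> span ((\<lambda>j. a j x) ` T)" for w x y
    proof -
      have "orthogonal (G x y) w"
        by (rule orthogonal_to_span[OF that]) (auto simp: orthogonal_def inner_commute[of "G x y"] perp)
      then show ?thesis by (simp add: orthogonal_def inner_commute)
    qed
    have r0: "r x \<noteq> 0 \<longleftrightarrow> a k x \<notin> span ((\<lambda>j. a j x) ` T)" if "D x \<noteq> 0" for x
    proof
      assume "r x \<noteq> 0"
      show "a k x \<notin> span ((\<lambda>j. a j x) ` T)"
      proof
        assume "a k x \<in> span ((\<lambda>j. a j x) ` T)"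
        then have "r x \<in> span ((\<lambda>j. a j x) ` T)"
          using span_diff[OF span_scale spn[of x "a k x"], of "a k x" "D x"] by (simp add: r_def)
        then have "r x \<bullet> r x = 0" using perp_span by (simp add: r_def)
        then show False using \<open>r x \<noteq> 0\<close> by simp
      qed
    next
      assume "a k x \<notin> span ((\<lambda>j. a j x) ` T)"
      moreover have "a k x \<in> span ((\<lambda>j. a j x) ` T)" if "r x = 0"
        using span_scale[OF spn[of x "a k x"], of "1 / D x"] that \<open>D x \<noteq> 0\<close> by (simp add: r_def)
      ultimately show "r x \<noteq> 0" by blast
    qed
    show ?case
    proof (rule exI[of _ D'], rule exI[of _ G'], intro conjI allI impI ballI)
      show "D' \<in> \<A>" unfolding D'_def using DA rA by auto
      show "coords_in \<A> (\<lambda>x. G' x (y x))" if "coords_in \<A> y" for y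
        unfolding G'_def using GA[OF that] rA by (intro coords_diff coords_scaleR coords_inner)
    next
      fix x
      show "D' x \<noteq> 0 \<longleftrightarrow> lin_indep_on (\<lambda>j. a j x) (insert k T)"
        using r0[of x] D[of x] insert.hyps by (auto simp: D'_def lin_indep_on_insert)
    next
      show "linear (G' x)" for x
        by (rule linearI) (simp_all add: G'_def linear_add[OF lin] linear_scale[OF lin] algebra_simps)
    next
      fix x y assume "D' x = 0"
      then show "G' x y = 0" by (auto simp: D'_def G'_def G0)
    next
      fix x y j assume j: "j \<in> insert k T"
      show "a j x \<bullet> G' x y = 0"
      proof (cases "j = k")
        case False
        then show ?thesis using j by (simp add: G'_def inner_diff_right r_def perp)
      next
        case True
        show ?thesis
        proof (cases "D x = 0")
          case True
          then show ?thesis by (simp add: G'_def G0)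
        next
          case False
          have "(D x *\<^sub>R a k x - r x) \<bullet> G' x y = 0"
            using perp_span[OF spn[of x "a k x"]] by (simp add: G'_def inner_diff_right r_def)
          moreover have "r x \<bullet> G' x y = 0" by (simp add: G'_def inner_diff_right inner_commute)
          ultimately have "D x * (a k x \<bullet> G' x y) = 0" by (simp add: inner_diff_left)
          then show ?thesis using False True \<open>j = k\<close> by simp
        qed
      qed
    next
      fix x y
      let ?S = "span ((\<lambda>j. a j x) ` insert k T)"
      have sub: "span ((\<lambda>j. a j x) ` T) \<subseteq> ?S" by (intro span_mono) auto
      have 1: "(r x \<bullet> r x) *\<^sub>R (D x *\<^sub>R y - G x y) \<in> ?S" using spn sub by (intro span_scale) auto
      have "a k x \<in> ?S" by (rule span_base) simp
      moreover have "D x *\<^sub>R a k x - r x \<in> ?S" using spn[of x "a k x"] sub by (auto simp: r_def)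
      ultimately have "r x \<in> ?S" using span_diff[OF span_scale, of "a k x" _ "D x *\<^sub>R a k x - r x" "D x"] by simp
      then have 2: "(G x y \<bullet> r x) *\<^sub>R r x \<in> ?S" by (rule span_scale)
      have "D' x *\<^sub>R y - G' x y = (r x \<bullet> r x) *\<^sub>R (D x *\<^sub>R y - G x y) + (G x y \<bullet> r x) *\<^sub>R r x"
        by (simp add: D'_def G'_def algebra_simps)
      then show "D' x *\<^sub>R y - G' x y \<in> ?S" using span_add[OF 1 2] by simp
    qed
  qed
  then show ?thesis by (elim exE conjE) (rule that, assumption+, simp_all)
qed

end

section \<open>Rational functions of one variable\<close>

text \<open>This dual form of spanning is the one that meets stresses: their kernel vectors have
  entries \<open>q j \<bullet> z\<close>, and zero entries say that \<open>z\<close> is orthogonal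
  to some of the \<open>q j\<close>.\<close>

definition spans :: "('i \<Rightarrow> 'e::euclidean_space) \<Rightarrow> 'i set \<Rightarrow> bool" where
  "spans q S \<longleftrightarrow> (\<forall>z. (\<forall>j\<in>S. q j \<bullet> z = 0) \<longrightarrow> z = 0)"

lemma spans_mono: "spans q S \<Longrightarrow> S \<subseteq> S' \<Longrightarrow> spans q S'"
  by (auto simp: spans_def)

lemma spans_iff_span: "spans q S \<longleftrightarrow> span (q ` S) = UNIV"
proof
  assume L: "spans q S"
  show "span (q ` S) = UNIV"
  proof (rule ccontr)
    assume "span (q ` S) \<noteq> UNIV"
    then obtain a where "a \<noteq> 0" "span (q ` S) \<subseteq> {x. a \<bullet> x = 0}"
      using span_not_univ_subset_hyperplane by blast
    then have "\<forall>j\<in>S. q j \<bullet> a = 0" by (auto simp: inner_commute[of _ a] span_base subset_iff)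
    then show False using L \<open>a \<noteq> 0\<close> by (auto simp: spans_def)
  qed
next
  assume R: "span (q ` S) = UNIV"
  show "spans q S"
    unfolding spans_def
  proof (intro allI impI)
    fix z assume z: "\<forall>j\<in>S. q j \<bullet> z = 0"
    have "orthogonal z z"
      by (rule orthogonal_to_span[of z "q ` S"]) (use R z in \<open>auto simp: orthogonal_def inner_commute[of z]\<close>)
    then show "z = 0" by (simp add: orthogonal_def)
  qed
qed

text \<open>For finite \<open>S\<close> this turns spanning into a finite disjunction of
  independence conditions, each of which is the nonvanishing of one function \<open>D\<close> from
  \<open>gram_schmidt\<close>.\<close>

lemma spans_iff_lin_indep_on:
  fixes q :: "'i \<Rightarrow> 'e::euclidean_space"
  shows "spans q S \<longleftrightarrow> (\<exists>T\<subseteq>S. finite T \<and> card T = DIM('e) \<and> lin_indep_on q T)"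
proof
  assume "spans q S"
  then have sp: "span (q ` S) = UNIV" by (simp add: spans_iff_span)
  obtain B where B: "B \<subseteq> q ` S" "independent B" "q ` S \<subseteq> span B" "card B = dim (q ` S)"
    using basis_exists by blast
  obtain T where T: "T \<subseteq> S" "inj_on q T" "q ` T = B"
    using B(1) by (metis subset_image_inj)
  have cB: "card B = DIM('e)" using B(4) sp by (metis dim_UNIV dim_span)
  then have "finite B" using card_eq_0_iff by (metis DIM_positive less_irrefl)
  then show "\<exists>T\<subseteq>S. finite T \<and> card T = DIM('e) \<and> lin_indep_on q T"
    using T B cB by (intro exI[of _ T]) (auto simp: lin_indep_on_def card_image dest: finite_imageD)
next
  assume "\<exists>T\<subseteq>S. finite T \<and> card T = DIM('e) \<and> lin_indep_on q T"
  then obtain T where T: "T \<subseteq> S" "card T = DIM('e)" "inj_on q T" "independent (q ` T)"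
    by (auto simp: lin_indep_on_def)
  then have "card (q ` T) = DIM('e)" by (simp add: card_image)
  then have "span (q ` T) = UNIV" using T(4)
    by (metis dim_eq_full dim_span_eq_card_independent dim_span)
  then show "spans q S" using T(1) spans_iff_span spans_mono by metis
qed

lemma spans_imp_lin_indep_on:
  fixes q :: "'i \<Rightarrow> 'e::euclidean_space"
  assumes "spans q S" "finite S" "card S = DIM('e)"
  shows "lin_indep_on q S"
  using assms by (metis card_subset_eq spans_iff_lin_indep_on)

text \<open>The values at the zeros of the denominator, none of which lies in \<open>Z\<close>, are arbitrary.\<close>

definition rat :: "real set \<Rightarrow> (real \<Rightarrow> real) set" where
  "rat Z = {h. \<exists>a b. b \<noteq> 0 \<and> (\<forall>z\<in>Z. poly b z \<noteq> 0) \<and>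
     (\<forall>t. poly b t \<noteq> 0 \<longrightarrow> h t = poly a t / poly b t)}"

lemma ratI:
  assumes "b \<noteq> 0" "\<And>z. z \<in> Z \<Longrightarrow> poly b z \<noteq> 0" "\<And>t. poly b t \<noteq> 0 \<Longrightarrow> h t = poly a t / poly b t"
  shows "h \<in> rat Z"
  using assms by (auto simp: rat_def)

lemma ratE:
  assumes "h \<in> rat Z"
  obtains a b where "b \<noteq> 0" "\<And>z. z \<in> Z \<Longrightarrow> poly b z \<noteq> 0"
    "\<And>t. poly b t \<noteq> 0 \<Longrightarrow> h t = poly a t / poly b t"
  using assms by (auto simp: rat_def)

lemma rat_mono: "Z' \<subseteq> Z \<Longrightarrow> rat Z \<subseteq> rat Z'"
  unfolding rat_def by blast

interpretation rat: function_algebra "rat Z" for Z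
proof
  fix c show "(\<lambda>_. c) \<in> rat Z"
    by (rule ratI[of 1 _ _ "[:c:]"]) auto
next
  fix f g assume "f \<in> rat Z" "g \<in> rat Z"
  then obtain a b a' b'
    where "b \<noteq> 0" "\<And>z. z \<in> Z \<Longrightarrow> poly b z \<noteq> 0" "\<And>t. poly b t \<noteq> 0 \<Longrightarrow> f t = poly a t / poly b t"
      and "b' \<noteq> 0" "\<And>z. z \<in> Z \<Longrightarrow> poly b' z \<noteq> 0" "\<And>t. poly b' t \<noteq> 0 \<Longrightarrow> g t = poly a' t / poly b' t"
    by (metis ratE)
  note fg = this
  show "(\<lambda>x. f x + g x) \<in> rat Z"
    by (rule ratI[of "b * b'" _ _ "a * b' + a' * b"]) (use fg in \<open>auto simp: add_frac_eq\<close>)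
  show "(\<lambda>x. f x * g x) \<in> rat Z"
    by (rule ratI[of "b * b'" _ _ "a * a'"]) (use fg in auto)
qed

lemma rat_id: "(\<lambda>t. t) \<in> rat Z"
  by (rule ratI[of 1 _ _ "[:0, 1:]"]) auto

text \<open>The denominator is nonzero at \<open>z\<close>, so the nonzero value there shows that
  the numerator is not the zero polynomial; only the roots of these two polynomials can be
  exceptional. All genericity along curves comes from this fact.\<close>

lemma rat_nonzero_cofinite:
  assumes "h \<in> rat Z" "z \<in> Z" "h z \<noteq> 0"
  shows "\<forall>\<^sub>F t in cofinite. h t \<noteq> 0"
proof -
  obtain a b where b: "b \<noteq> 0" "\<And>z. z \<in> Z \<Longrightarrow> poly b z \<noteq> 0"
    and h: "\<And>t. poly b t \<noteq> 0 \<Longrightarrow> h t = poly a t / poly b t"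
    using assms(1) by (auto elim: ratE)
  have "poly a z \<noteq> 0" using assms(2,3) b(2) h by fastforce
  then have "a \<noteq> 0" by auto
  then have "finite ({t. poly a t = 0} \<union> {t. poly b t = 0})"
    using b by (simp add: poly_roots_finite)
  then show ?thesis
    unfolding eventually_cofinite by (rule rev_finite_subset) (auto simp: h)
qed

lemma rat_inverse:
  assumes h: "h \<in> rat Z" and nz: "\<And>z. z \<in> Z \<Longrightarrow> h z \<noteq> 0" and "Z \<noteq> {}"
  shows "(\<lambda>t. 1 / h t) \<in> rat Z"
proof -
  obtain a b where b: "b \<noteq> 0" "\<And>z. z \<in> Z \<Longrightarrow> poly b z \<noteq> 0"
    and h: "\<And>t. poly b t \<noteq> 0 \<Longrightarrow> h t = poly a t / poly b t"
    using assms(1) by (auto elim: ratE)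
  have a: "poly a z \<noteq> 0" if "z \<in> Z" for z using nz[OF that] b(2) h that by fastforce
  with \<open>Z \<noteq> {}\<close> have "a \<noteq> 0" by auto
  \<comment> \<open>The fraction is \<open>b * b / (a * b)\<close> and not \<open>b / a\<close>: the
    denominator must also vanish at the roots of \<open>b\<close>, where nothing is known about
    \<open>h\<close>.\<close>
  with a b h show ?thesis
    by (intro ratI[of "a * b" _ _ "b * b"]) auto
qed

lemma rat_isCont:
  assumes "h \<in> rat Z" "z \<in> Z"
  shows "isCont h z"
proof -
  obtain a b where b: "b \<noteq> 0" "\<And>z. z \<in> Z \<Longrightarrow> poly b z \<noteq> 0"
    and h: "\<And>t. poly b t \<noteq> 0 \<Longrightarrow> h t = poly a t / poly b t"
    using assms(1) by (auto elim: ratE)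
  have "open {t. poly b t \<noteq> 0}" by (intro open_Collect_neq continuous_intros)
  then have "\<forall>\<^sub>F t in nhds z. poly b t \<noteq> 0"
    using b(2)[OF assms(2)] eventually_nhds_in_open[of "{t. poly b t \<noteq> 0}" z] by simp
  then have ev: "\<forall>\<^sub>F t in nhds z. h t = poly a t / poly b t"
    by (rule eventually_mono) (rule h)
  have "isCont (\<lambda>t. poly a t / poly b t) z"
    using b(2)[OF assms(2)] by (intro continuous_intros) auto
  then show ?thesis using isCont_cong[OF ev] by simp
qed

lemma rat_coords_isCont:
  assumes "coords_in (rat Z) c" "z \<in> Z"
  shows "isCont c z"
proof -
  have "isCont (\<lambda>t. \<Sum>b\<in>Basis. (c t \<bullet> b) *\<^sub>R b) z"
    using assms rat_isCont[of _ Z z] unfolding coords_in_def by (intro continuous_sum continuous_scaleR continuous_const) auto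
  then show ?thesis by (simp add: euclidean_representation)
qed

lemma rat_coords_mono: "coords_in (rat Z) f \<Longrightarrow> Z' \<subseteq> Z \<Longrightarrow> coords_in (rat Z') f"
  using rat_mono[of Z' Z] by (auto simp: coords_in_def)

lemma rat_lin_indep_on:
  assumes "finite T" "\<And>j. j \<in> T \<Longrightarrow> coords_in (rat Z) (a j)"
    and "z \<in> Z" "lin_indep_on (\<lambda>j. a j z) T"
  shows "\<forall>\<^sub>F t in cofinite. lin_indep_on (\<lambda>j. a j t) T"
proof -
  obtain D where "D \<in> rat Z"
    and "\<forall>t. D t \<noteq> 0 \<longleftrightarrow> lin_indep_on (\<lambda>j. a j t) T"
    by (rule rat.gram_schmidt[of T Z a, OF assms(1)], erule assms(2), rule that, assumption+)
  then show ?thesis using rat_nonzero_cofinite[of D Z z] assms(3,4) by simp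
qed

lemma rat_spans:
  assumes "\<And>j. j \<in> S \<Longrightarrow> coords_in (rat Z) (q j)"
    and "z \<in> Z" "spans (\<lambda>j. q j z) S"
  shows "\<forall>\<^sub>F t in cofinite. spans (\<lambda>j. q j t) S"
proof -
  obtain T where T: "T \<subseteq> S" "finite T" "card T = DIM('b)" "lin_indep_on (\<lambda>j. q j z) T"
    using assms(3) unfolding spans_iff_lin_indep_on by blast
  then have "\<forall>\<^sub>F t in cofinite. lin_indep_on (\<lambda>j. q j t) T"
    using assms(1,2) by (intro rat_lin_indep_on[of T Z q z]) auto
  then show ?thesis
    by (rule eventually_mono) (use T in \<open>auto simp: spans_iff_lin_indep_on\<close>)
qed

text \<open>The projection is \<open>G\<close> divided by \<open>D\<close>. Independence at the
  points of \<open>Z\<close> keeps \<open>D\<close> nonzero there, so the quotient stays in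
  \<open>rat Z\<close>. At these points \<open>D z *\<^sub>R x z - G z (x z)\<close> lies in the
  span of the constraints and is orthogonal to it, hence zero, so \<open>x z\<close> is fixed. At
  all other times orthogonality survives because \<open>G\<close> is orthogonal to the constraints
  everywhere.\<close>

lemma rat_project:
  fixes a :: "'i \<Rightarrow> real \<Rightarrow> 'e::euclidean_space"
  assumes "finite T" "\<And>j. j \<in> T \<Longrightarrow> coords_in (rat Z) (a j)" "coords_in (rat Z) x"
    and ind: "\<And>z. z \<in> Z \<Longrightarrow> lin_indep_on (\<lambda>j. a j z) T"
    and perp: "\<And>z j. z \<in> Z \<Longrightarrow> j \<in> T \<Longrightarrow> a j z \<bullet> x z = 0" and "Z \<noteq> {}"
  obtains y where "coords_in (rat Z) y" "\<And>z. z \<in> Z \<Longrightarrow> y z = x z"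
    "\<And>t j. j \<in> T \<Longrightarrow> a j t \<bullet> y t = 0"
proof -
  obtain D G where D: "D \<in> rat Z"
    and G: "\<forall>y. coords_in (rat Z) y \<longrightarrow> coords_in (rat Z) (\<lambda>t. G t (y t))"
    and D0: "\<forall>t. D t \<noteq> 0 \<longleftrightarrow> lin_indep_on (\<lambda>j. a j t) T"
    and Gp: "\<forall>t y. \<forall>j\<in>T. a j t \<bullet> G t y = 0"
    and sp: "\<forall>t y. D t *\<^sub>R y - G t y \<in> span ((\<lambda>j. a j t) ` T)"
    by (rule rat.gram_schmidt[of T Z a, OF assms(1)], erule assms(2), rule that, assumption+)
  show ?thesis
  proof
    show "coords_in (rat Z) (\<lambda>t. (1 / D t) *\<^sub>R G t (x t))"
      using D0 ind assms(3,6) by (intro rat.coords_scaleR rat_inverse D G[rule_format]) auto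
    show "a j t \<bullet> (1 / D t) *\<^sub>R G t (x t) = 0" if "j \<in> T" for t j
      using Gp that by simp
    fix z assume z: "z \<in> Z"
    let ?w = "D z *\<^sub>R x z - G z (x z)"
    have "orthogonal ?w ?w"
      by (rule orthogonal_to_span[OF sp[rule_format]])
        (auto simp: orthogonal_def inner_commute[of ?w] inner_diff_right Gp perp[OF z])
    then have "G z (x z) = D z *\<^sub>R x z" by (simp add: orthogonal_def)
    moreover have "D z \<noteq> 0" using D0 ind[OF z] by blast
    ultimately show "(1 / D z) *\<^sub>R G z (x z) = x z" by simp
  qed
qed

section \<open>Stresses and rational families of stresses\<close>

text \<open>As \<open>i\<close> itself is left out, the complement is the closed neighbourhood of
  \<open>i\<close>, the set of vertices whose points must have full affine span.\<close>

definition nonnbrs :: "'n set set \<Rightarrow> 'n \<Rightarrow> 'n set" where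
  "nonnbrs E i = {j. j \<noteq> i \<and> {i, j} \<notin> E}"

lemma nonnbrs_sym: "j \<in> nonnbrs E i \<longleftrightarrow> i \<in> nonnbrs E j"
  by (auto simp: nonnbrs_def insert_commute)

text \<open>For \<open>q = homog p\<close> the range consists of the affine functions evaluated at
  the points of the framework: the space that every equilibrium stress matrix annihilates.\<close>

definition vals :: "('n::finite \<Rightarrow> 'e::euclidean_space) \<Rightarrow> 'e \<Rightarrow> real ^ 'n" where
  "vals q z = (\<chi> i. q i \<bullet> z)"

lemma vals_nth [simp]: "vals q z $ i = q i \<bullet> z"
  by (simp add: vals_def)

lemma linear_vals: "linear (vals q)"
  by (rule linearI) (auto simp: vec_eq_iff inner_add_right)

lemma inner_vals: "x \<bullet> vals q z = (\<Sum>i\<in>UNIV. (x $ i) *\<^sub>R q i) \<bullet> z"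
  by (simp add: inner_vec_def inner_sum_left)

lemma inner_vals_eq_0_iff: "(\<forall>z. x \<bullet> vals q z = 0) \<longleftrightarrow> (\<Sum>i\<in>UNIV. (x $ i) *\<^sub>R q i) = 0"
  unfolding inner_vals by (metis inner_eq_zero_iff inner_zero_left)

lemma stress_vals_iff:
  fixes \<Omega> :: "real ^ 'n ^ 'n"
  shows "(\<forall>i. (\<Sum>j\<in>UNIV. (\<Omega> $ i $ j) *\<^sub>R q j) = 0) \<longleftrightarrow> (\<forall>z. \<Omega> *v vals q z = 0)"
  by (auto simp: vec_eq_iff matrix_vector_mul_component inner_vals_eq_0_iff[symmetric])

lemma inner_symmetric_matrix:
  fixes A :: "real ^ 'n ^ 'n"
  assumes "transpose A = A"
  shows "x \<bullet> (A *v y) = (A *v x) \<bullet> y"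
  using dot_lmul_matrix[of x A y] vector_transpose_matrix[of x A] assms by simp

lemma subspace_decomp:
  fixes A :: "'a::euclidean_space set"
  assumes "subspace A"
  obtains y u where "y \<in> A" "\<forall>a\<in>A. orthogonal u a" "x = y + u"
proof (rule orthogonal_subspace_decomp_exists[of A x])
  fix y u assume *: "y \<in> span A" "\<And>w. w \<in> span A \<Longrightarrow> orthogonal u w" "x = y + u"
  have "span A = A" using assms by simp
  note * = *[unfolded this]
  show ?thesis by (rule that[OF *(1) _ *(3)]) (use *(2) in blast)
qed

text \<open>Maximal rank is expressed as minimality of the kernel; \<open>rank_eq_iff_kernel\<close>
  translates when \<open>q\<close> spans. The vectors \<open>q i\<close> are arbitrary, without a
  last coordinate 1, because the curves are first built homogeneously.\<close>

definition stressed :: "'n::finite set set \<Rightarrow> ('n \<Rightarrow> 'e::euclidean_space) \<Rightarrow> bool" where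
  "stressed E q \<longleftrightarrow> (\<exists>\<Omega> :: real ^ 'n ^ 'n. transpose \<Omega> = \<Omega> \<and>
     (\<forall>i. \<forall>j\<in>nonnbrs E i. \<Omega> $ i $ j = 0) \<and>
     (\<forall>z. \<Omega> *v vals q z = 0) \<and>
     (\<forall>x. \<Omega> *v x = 0 \<longrightarrow> x \<in> range (vals q)))"

definition locally_spanning :: "'n set set \<Rightarrow> ('n \<Rightarrow> 'e::euclidean_space) \<Rightarrow> bool" where
  "locally_spanning E q \<longleftrightarrow> (\<forall>i. spans q (- nonnbrs E i))"

lemma locally_spanning_imp_spans: "locally_spanning E q \<Longrightarrow> spans q UNIV"
  by (auto simp: locally_spanning_def intro: spans_mono)

text \<open>The rows of \<open>\<Omega>\<close> together with the vectors \<open>vals q c\<close>.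
  With \<open>c\<close> ranging over \<open>Basis\<close>, a vector orthogonal to all of them is a
  kernel vector of \<open>\<Omega>\<close> that is also orthogonal to the range of
  \<open>vals q\<close>.\<close>

definition stress_system ::
    "real ^ 'n ^ 'n \<Rightarrow> ('n::finite \<Rightarrow> 'e::euclidean_space) \<Rightarrow> 'n + 'e \<Rightarrow> real ^ 'n" where
  "stress_system \<Omega> q = case_sum (\<lambda>i. \<Omega> $ i) (vals q)"

text \<open>Rephrases maximality of the rank as an open condition on the pair \<open>(\<Omega>, q)\<close>.\<close>

lemma kernel_le_vals_iff:
  fixes q :: "'n::finite \<Rightarrow> 'e::euclidean_space"
  assumes "\<And>z. \<Omega> *v vals q z = 0"
  shows "(\<forall>x. \<Omega> *v x = 0 \<longrightarrow> x \<in> range (vals q)) \<longleftrightarrow>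
    spans (stress_system \<Omega> q) (UNIV <+> Basis)"
proof
  assume L: "\<forall>x. \<Omega> *v x = 0 \<longrightarrow> x \<in> range (vals q)"
  show "spans (stress_system \<Omega> q) (UNIV <+> Basis)"
    unfolding spans_def
  proof (intro allI impI)
    fix w :: "real ^ 'n" assume w: "\<forall>j\<in>UNIV <+> Basis. stress_system \<Omega> q j \<bullet> w = 0"
    have "\<Omega> $ i \<bullet> w = 0" for i using w by (auto simp: stress_system_def dest: bspec[of _ _ "Inl i"])
    then have "\<Omega> *v w = 0" by (simp add: vec_eq_iff matrix_vector_mul_component)
    then obtain z where z: "w = vals q z" using L by auto
    have "(\<Sum>i\<in>UNIV. (w $ i) *\<^sub>R q i) \<bullet> c = 0" if "c \<in> Basis" for c
      using bspec[OF w InrI[OF that]]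
      unfolding inner_vals[symmetric] by (simp add: stress_system_def inner_commute)
    then have "(\<Sum>i\<in>UNIV. (w $ i) *\<^sub>R q i) = 0"
      using euclidean_all_zero_iff by blast
    \<comment> \<open>\<open>w\<close> lies in the range of \<open>vals q\<close> and is orthogonal
      to that range, hence to itself.\<close>
    then show "w = 0" using inner_vals_eq_0_iff[of w q] z by (metis inner_eq_zero_iff)
  qed
next
  assume R: "spans (stress_system \<Omega> q) (UNIV <+> Basis)"
  show "\<forall>x. \<Omega> *v x = 0 \<longrightarrow> x \<in> range (vals q)"
  proof (intro allI impI)
    fix x assume x: "\<Omega> *v x = 0"
    have sub: "subspace (range (vals q))"
      by (rule linear_subspace_image[OF linear_vals subspace_UNIV])
    obtain y w where y': "y \<in> range (vals q)"
      and w: "\<forall>u\<in>range (vals q). orthogonal w u" and xyw: "x = y + w"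
      by (rule subspace_decomp[OF sub])
    then have "\<Omega> *v y = 0" using assms by auto
    then have "\<Omega> *v w = 0" using x xyw by (simp add: matrix_vector_right_distrib)
    then have "\<forall>i. \<Omega> $ i \<bullet> w = 0" by (auto simp: vec_eq_iff matrix_vector_mul_component)
    moreover have "vals q c \<bullet> w = 0" for c
      using w by (auto simp: orthogonal_def inner_commute)
    ultimately have "\<forall>j\<in>UNIV <+> Basis. stress_system \<Omega> q j \<bullet> w = 0"
      by (auto simp: stress_system_def)
    then have "w = 0" using R unfolding spans_def by blast
    then show "x \<in> range (vals q)" using y' xyw by simp
  qed
qed

text \<open>The factors of \<open>\<Omega>\<^sub>i\<^sub>j = v\<^sub>i \<bullet> B v\<^sub>j\<close> should have size \<open>n - d - 1\<close>, for which there is no type; a set \<open>R\<close>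
  of that many vertices serves as index set instead, and the entries of the \<open>v\<^sub>i\<close> outside \<open>R\<close> are
  irrelevant because \<open>B\<close> vanishes there.\<close>

definition factored ::
    "'n::finite set set \<Rightarrow> 'n set \<Rightarrow> real ^ 'n ^ 'n \<Rightarrow> ('n \<Rightarrow> real ^ 'n) \<Rightarrow> ('n \<Rightarrow> 'e::euclidean_space) \<Rightarrow> bool" where
  "factored E R B v q \<longleftrightarrow> transpose B = B \<and> (\<forall>k l. k \<notin> R \<longrightarrow> B $ k $ l = 0) \<and>
     (\<forall>i. \<forall>j\<in>nonnbrs E i. v i \<bullet> (B *v v j) = 0) \<and>
     (\<forall>k\<in>R. (\<Sum>i\<in>UNIV. (v i $ k) *\<^sub>R q i) = 0) \<and>
     (\<forall>x :: real ^ 'n. (\<forall>i. v i \<bullet> (B *v (\<Sum>j\<in>UNIV. (x $ j) *\<^sub>R v j)) = 0) \<longrightarrow> x \<in> range (vals q)) \<and>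
     lin_indep_on (\<lambda>k. \<chi> i. v i $ k) R"

text \<open>Let \<open>W\<close> be the orthogonal complement of the range of \<open>vals q\<close>.
  A symmetric \<open>\<Omega>\<close> that kills this range also maps into \<open>W\<close>, so it
  is determined by its matrix \<open>B\<close> in an orthonormal basis \<open>w\<close> of
  \<open>W\<close>. Since \<open>dim W = card R\<close>, the basis can be indexed by
  \<open>R\<close>, and \<open>v i\<close> collects the \<open>i\<close>-th entries of the basis
  vectors.\<close>

lemma stressed_imp_factored:
  fixes q :: "'n::finite \<Rightarrow> 'e::euclidean_space"
  assumes "stressed E q" "spans q UNIV" "card R + DIM('e) = CARD('n)"
  obtains B v where "factored E R B v q"
proof -
  obtain \<Omega> :: "real ^ 'n ^ 'n" where \<Omega>: "transpose \<Omega> = \<Omega> \<and>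
     (\<forall>i. \<forall>j\<in>nonnbrs E i. \<Omega> $ i $ j = 0) \<and> (\<forall>z. \<Omega> *v vals q z = 0) \<and>
     (\<forall>x. \<Omega> *v x = 0 \<longrightarrow> x \<in> range (vals q))"
    using assms(1) unfolding stressed_def by (elim exE)
  have sym: "transpose \<Omega> = \<Omega>" and non: "\<And>i j. j \<in> nonnbrs E i \<Longrightarrow> \<Omega> $ i $ j = 0"
    and eq: "\<And>z. \<Omega> *v vals q z = 0" and ker: "\<And>x. \<Omega> *v x = 0 \<Longrightarrow> x \<in> range (vals q)"
    using \<Omega> by simp_all
  define A where "A = range (vals q)"
  define W where "W = {y. \<forall>x\<in>A. orthogonal x y}"
  have subA: "subspace A" unfolding A_def by (rule linear_subspace_image[OF linear_vals subspace_UNIV])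
  have "inj (vals q)"
    using assms(2) by (auto simp: linear_injective_0[OF linear_vals] spans_def vec_eq_iff)
  then have dimA: "dim A = DIM('e)"
    unfolding A_def using dim_image_eq[OF linear_vals, of q UNIV] by simp
  have subW: "subspace W"
    unfolding W_def by (rule subspace_orthogonal_to_vectors)
  have "dim W + dim A = CARD('n)"
    using dim_subspace_orthogonal_to_vectors[OF subA subspace_UNIV] by (simp add: W_def)
  then have dimW: "dim W = card R" using assms(3) dimA by simp
  obtain C where C: "C \<subseteq> W" "pairwise orthogonal C" "\<And>x. x \<in> C \<Longrightarrow> norm x = 1"
      "independent C" "card C = dim W" "span C = W"
    by (rule orthonormal_basis_subspace[OF subW]) (rule that; blast)
  have finC: "finite C" using C(4) independent_imp_finite by blast
  obtain w where w: "bij_betw w R C"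
    using finite_same_card_bij[of R C] finC C(5) dimW by auto
  \<comment> \<open>The orthogonal projection onto \<open>W\<close>, written in the basis
    \<open>w\<close>.\<close>
  define \<pi> where "\<pi> = (\<lambda>x. \<Sum>k\<in>R. (w k \<bullet> x) *\<^sub>R w k)"
  have piW: "\<pi> x = x" if "x \<in> W" for x
  proof -
    have "\<pi> x = (\<Sum>c\<in>C. (c \<bullet> x) *\<^sub>R c)" unfolding \<pi>_def by (rule sum.reindex_bij_betw[OF w])
    also have "\<dots> = x"
      using orthonormal_basis_expand[OF C(2,3) _ finC, of x] that C(6) by (simp add: inner_commute)
    finally show ?thesis .
  qed
  have wW: "w k \<in> W" if "k \<in> R" for k using w that C(1) by (auto simp: bij_betw_def)
  have Opi: "\<Omega> *v \<pi> x = \<Omega> *v x" for x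
  proof -
    obtain y u where yA: "y \<in> A" and u: "\<forall>a\<in>A. orthogonal u a" and x: "x = y + u"
      by (rule subspace_decomp[OF subA])
    have uW: "u \<in> W" unfolding W_def using u by (auto simp: orthogonal_commute)
    have "w k \<bullet> y = 0" if "k \<in> R" for k
      using wW[OF that] yA by (auto simp: W_def orthogonal_def inner_commute)
    then have "\<pi> x = \<pi> u" by (simp add: \<pi>_def x inner_add_right)
    then have "\<pi> x = u" using piW[OF uW] by simp
    moreover have "\<Omega> *v y = 0" using yA eq by (auto simp: A_def)
    ultimately show ?thesis by (simp add: x matrix_vector_right_distrib)
  qed
  have OW: "\<Omega> *v x \<in> W" for x
    unfolding W_def using eq by (auto simp: A_def orthogonal_def inner_symmetric_matrix[OF sym])
  define v where "v = (\<lambda>i. (\<chi> k. if k \<in> R then w k $ i else 0) :: real ^ 'n)"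
  define B where "B = ((\<chi> k l. if k \<in> R \<and> l \<in> R then w k \<bullet> (\<Omega> *v w l) else 0) :: real ^ 'n ^ 'n)"
  have V: "(\<Sum>j\<in>UNIV. (x $ j) *\<^sub>R v j) = (\<chi> k. if k \<in> R then w k \<bullet> x else 0)" for x :: "real ^ 'n"
    by (auto simp: vec_eq_iff v_def inner_vec_def mult.commute)
  \<comment> \<open>With \<open>x = axis j 1\<close> this is the factorization of the entry
    \<open>\<Omega> $ i $ j\<close>; for general \<open>x\<close> it transfers the kernel of
    \<open>\<Omega>\<close>.\<close>
  have key: "v i \<bullet> (B *v (\<Sum>j\<in>UNIV. (x $ j) *\<^sub>R v j)) = (\<Omega> *v x) $ i" for x i
  proof -
    have "(B *v (\<Sum>j\<in>UNIV. (x $ j) *\<^sub>R v j)) $ k = w k \<bullet> (\<Omega> *v x)" if "k \<in> R" for k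
    proof -
      have "(B *v (\<Sum>j\<in>UNIV. (x $ j) *\<^sub>R v j)) $ k =
          (\<Sum>l\<in>UNIV. if l \<in> R then (w k \<bullet> (\<Omega> *v w l)) * (w l \<bullet> x) else 0)"
        unfolding V by (auto simp: matrix_vector_mult_def B_def that intro!: sum.cong)
      also have "\<dots> = (\<Sum>l\<in>R. (w k \<bullet> (\<Omega> *v w l)) * (w l \<bullet> x))"
        by (simp add: sum.If_cases)
      also have "\<dots> = w k \<bullet> (\<Omega> *v \<pi> x)"
        by (simp add: \<pi>_def inner_sum_right linear_sum[OF matrix_vector_mul_linear]
            matrix_vector_mult_scaleR mult.commute)
      finally show ?thesis by (simp add: Opi)
    qed
    then have "v i \<bullet> (B *v (\<Sum>j\<in>UNIV. (x $ j) *\<^sub>R v j)) =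
        (\<Sum>k\<in>UNIV. if k \<in> R then w k $ i * (w k \<bullet> (\<Omega> *v x)) else 0)"
      unfolding inner_vec_def[of "v i"] by (auto simp: v_def intro!: sum.cong)
    also have "\<dots> = (\<pi> (\<Omega> *v x)) $ i"
      by (simp add: sum.If_cases \<pi>_def mult.commute)
    finally show ?thesis by (simp add: piW[OF OW])
  qed
  have "factored E R B v q"
    unfolding factored_def
  proof (intro conjI allI ballI impI)
    have "w k \<bullet> (\<Omega> *v w l) = w l \<bullet> (\<Omega> *v w k)" for k l
      unfolding inner_symmetric_matrix[OF sym, of "w k"] by (rule inner_commute)
    then show "transpose B = B"
      unfolding vec_eq_iff transpose_def B_def by auto
    show "B $ k $ l = 0" if "k \<notin> R" for k l using that by (simp add: B_def)
  next
    fix i j assume j: "j \<in> nonnbrs E i"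
    have "(\<Sum>l\<in>UNIV. (axis j (1::real) $ l) *\<^sub>R v l) = v j"
      by (simp add: axis_def if_distrib[of "\<lambda>c. c *\<^sub>R _"] cong: if_cong)
    then have "v i \<bullet> (B *v v j) = (\<Omega> *v axis j 1) $ i" using key[of i "axis j 1"] by simp
    also have "\<dots> = \<Omega> $ i $ j" by (simp add: matrix_vector_mult_basis column_def)
    finally show "v i \<bullet> (B *v v j) = 0" using non[OF j] by simp
  next
    fix k assume k: "k \<in> R"
    have "(\<Sum>i\<in>UNIV. (v i $ k) *\<^sub>R q i) = (\<Sum>i\<in>UNIV. (w k $ i) *\<^sub>R q i)"
      by (simp add: v_def k)
    also have "\<dots> = 0"
      using wW[OF k] unfolding inner_vals_eq_0_iff[symmetric] W_def A_def
      by (auto simp: orthogonal_def inner_commute)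
    finally show "(\<Sum>i\<in>UNIV. (v i $ k) *\<^sub>R q i) = 0" .
  next
    fix x assume "\<forall>i. v i \<bullet> (B *v (\<Sum>j\<in>UNIV. (x $ j) *\<^sub>R v j)) = 0"
    then have "\<Omega> *v x = 0" by (simp add: key vec_eq_iff)
    then show "x \<in> range (vals q)" by (rule ker)
  next
    have "(\<chi> i. v i $ k) = w k" if "k \<in> R" for k by (simp add: v_def that vec_eq_iff)
    then have "lin_indep_on (\<lambda>k. \<chi> i. v i $ k) R \<longleftrightarrow> lin_indep_on w R"
      unfolding lin_indep_on_def by (auto simp: inj_on_def cong: image_cong_simp)
    then show "lin_indep_on (\<lambda>k. \<chi> i. v i $ k) R"
      using w C(4) by (simp add: lin_indep_on_def bij_betw_def)
  qed
  then show ?thesis by (rule that)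
qed

text \<open>One half of Gale duality. The coefficients of a relation, extended by zero off
  \<open>T\<close>, form a kernel vector and hence equal \<open>vals q z\<close>. Then
  \<open>z\<close> is orthogonal to every \<open>q j\<close> with \<open>j\<close> outside
  \<open>T\<close>, so spanning there gives \<open>z = 0\<close>.\<close>

lemma factored_imp_lin_indep_on:
  fixes q :: "'n::finite \<Rightarrow> 'e::euclidean_space"
  assumes "factored E R B v q" "spans q (- T)"
  shows "lin_indep_on (\<lambda>j. B *v v j) T"
  unfolding lin_indep_on_iff[OF finite]
proof (intro allI impI)
  fix c assume c: "(\<Sum>j\<in>T. c j *\<^sub>R (B *v v j)) = 0"
  define x where "x = ((\<chi> j. if j \<in> T then c j else 0) :: real ^ 'n)"
  have "(\<Sum>j\<in>UNIV. (x $ j) *\<^sub>R v j) = (\<Sum>j\<in>UNIV. if j \<in> T then c j *\<^sub>R v j else 0)"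
    by (auto simp: x_def intro!: sum.cong)
  also have "\<dots> = (\<Sum>j\<in>T. c j *\<^sub>R v j)" by (simp add: sum.If_cases)
  finally have "B *v (\<Sum>j\<in>UNIV. (x $ j) *\<^sub>R v j) = 0"
    using c by (simp add: linear_sum[OF matrix_vector_mul_linear] matrix_vector_mult_scaleR)
  then have "x \<in> range (vals q)" using assms(1) unfolding factored_def by simp
  then obtain z where z: "x = vals q z" by blast
  have "q j \<bullet> z = 0" if "j \<in> - T" for j
    using that arg_cong[OF z, of "\<lambda>x. x $ j"] by (simp add: x_def)
  then have "z = 0" using assms(2) by (auto simp: spans_def)
  then have "x $ j = 0" for j by (simp add: z)
  then show "\<forall>j\<in>T. c j = 0" by (metis (mono_tags, lifting) vec_lambda_beta x_def)
qed

lemma matrix_vector_mult_eq_0_off: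
  fixes B :: "real ^ 'n ^ 'n"
  assumes "transpose B = B" "\<And>k l. k \<notin> R \<Longrightarrow> B $ k $ l = 0" "\<And>k. k \<in> R \<Longrightarrow> w $ k = 0"
  shows "B *v w = 0"
proof -
  have "B $ l $ k * w $ k = 0" for l k
    using assms(2)[of k l] assms(3)[of k] arg_cong[OF assms(1), of "\<lambda>A. A $ k $ l"]
    by (cases "k \<in> R") (auto simp: transpose_def)
  then have "(\<Sum>k\<in>UNIV. B $ l $ k * w $ k) = 0" for l by (intro sum.neutral) blast
  then show ?thesis by (simp add: vec_eq_iff matrix_vector_mult_def)
qed

text \<open>The other half of Gale duality. By the row equations, the combination of the
  \<open>v j\<close> with coefficients \<open>q j \<bullet> z\<close> vanishes in all entries from
  \<open>R\<close>, so \<open>B\<close> kills it. If \<open>z\<close> is orthogonal to the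
  \<open>q j\<close> outside \<open>T\<close>, this is a relation among the \<open>B *v v j\<close>
  with \<open>j\<close> in \<open>T\<close>, and all its coefficients are zero.\<close>

lemma lin_indep_on_imp_spans:
  fixes q :: "'n::finite \<Rightarrow> 'e::euclidean_space" and B :: "real ^ 'n ^ 'n"
  assumes B: "transpose B = B" "\<And>k l. k \<notin> R \<Longrightarrow> B $ k $ l = 0"
    and rows: "\<And>k. k \<in> R \<Longrightarrow> (\<Sum>i\<in>UNIV. (v i $ k) *\<^sub>R q i) = 0"
    and ind: "lin_indep_on (\<lambda>j. B *v v j) T" and "spans q UNIV"
  shows "spans q (- T)"
  unfolding spans_def
proof (intro allI impI)
  fix z assume z: "\<forall>j\<in>- T. q j \<bullet> z = 0"
  let ?w = "\<Sum>j\<in>UNIV. (q j \<bullet> z) *\<^sub>R v j"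
  have w0: "?w $ k = 0" if "k \<in> R" for k
    using arg_cong[OF rows[OF that], of "\<lambda>y. y \<bullet> z"] by (simp add: inner_sum_left mult.commute)
  have "B *v ?w = 0"
    by (rule matrix_vector_mult_eq_0_off[where R = R, OF B(1)], erule B(2), erule w0)
  moreover have "?w = (\<Sum>j\<in>T. (q j \<bullet> z) *\<^sub>R v j)"
    using z by (intro sum.mono_neutral_right) auto
  ultimately have "(\<Sum>j\<in>T. (q j \<bullet> z) *\<^sub>R (B *v v j)) = 0"
    by (simp add: linear_sum[OF matrix_vector_mul_linear] matrix_vector_mult_scaleR)
  moreover have "(\<Sum>j\<in>T. (q j \<bullet> z) *\<^sub>R (B *v v j)) = 0 \<longrightarrow> (\<forall>j\<in>T. q j \<bullet> z = 0)"
    using ind unfolding lin_indep_on_iff[OF finite] by (rule spec)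
  ultimately have "\<forall>j\<in>T. q j \<bullet> z = 0" by blast
  with z have "\<forall>j. q j \<bullet> z = 0" by blast
  then show "z = 0" using assms(5) by (simp add: spans_def)
qed

section \<open>Rational families of vectors and stresses, built vertex by vertex\<close>

lemma lin_indep_on_mono: "lin_indep_on a T \<Longrightarrow> S \<subseteq> T \<Longrightarrow> lin_indep_on a S"
  using independent_mono[of "a ` T" "a ` S"] by (auto simp: lin_indep_on_def intro: inj_on_subset)

lemma rat_matrix_vector_mult:
  fixes B :: "real \<Rightarrow> real ^ 'n ^ 'm"
  assumes "coords_in (rat Z) B" "coords_in (rat Z) v"
  shows "coords_in (rat Z) (\<lambda>t. B t *v v t)"
proof (rule rat.coords_vecI)
  fix i
  have "(\<lambda>t. B t $ i \<bullet> v t) \<in> rat Z"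
    using assms by (intro rat.coords_inner rat.coords_vec_nth)
  then show "coords_in (rat Z) (\<lambda>t. (B t *v v t) $ i)"
    by (simp add: rat.coords_real_iff matrix_vector_mul_component)
qed

text \<open>Each new vector is \<open>u k\<close> projected onto the \<open>B\<close>-orthogonal
  complement of the vectors of its already placed non-neighbours. At times in \<open>Z\<close> the
  given \<open>u\<close> satisfies these conditions and they are independent, so
  \<open>rat_project\<close> changes nothing there. A condition between two vertices of
  \<open>S\<close> is enforced when the later one is placed. The vertices of \<open>S0\<close> keep
  their vectors at all times, which permits a second stage with a smaller \<open>Z\<close>.\<close>

lemma extend_vertices:
  fixes u :: "'n::finite \<Rightarrow> real \<Rightarrow> real ^ 'n" and B :: "real \<Rightarrow> real ^ 'n ^ 'n"
  assumes Z: "Z \<noteq> {}" and B: "coords_in (rat Z) B" "\<And>t. transpose (B t) = B t"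
    and u: "\<And>i. coords_in (rat Z) (u i)"
    and perp: "\<And>z i j. z \<in> Z \<Longrightarrow> j \<in> nonnbrs E i \<Longrightarrow> i \<in> S0 \<union> S \<Longrightarrow> j \<in> S0 \<union> S \<Longrightarrow>
      u i z \<bullet> (B z *v u j z) = 0"
    and ind: "\<And>z i. z \<in> Z \<Longrightarrow> i \<in> S \<Longrightarrow> lin_indep_on (\<lambda>j. B z *v u j z) (nonnbrs E i \<inter> (S0 \<union> S))"
    and perp0: "\<And>t i j. j \<in> nonnbrs E i \<Longrightarrow> i \<in> S0 \<Longrightarrow> j \<in> S0 \<Longrightarrow> u i t \<bullet> (B t *v u j t) = 0"
    and "S0 \<inter> S = {}"
  obtains v where "\<And>i. coords_in (rat Z) (v i)" "\<And>i. i \<in> S0 \<Longrightarrow> v i = u i"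
    "\<And>i z. z \<in> Z \<Longrightarrow> v i z = u i z"
    "\<And>t i j. j \<in> nonnbrs E i \<Longrightarrow> i \<in> S0 \<union> S \<Longrightarrow> j \<in> S0 \<union> S \<Longrightarrow> v i t \<bullet> (B t *v v j t) = 0"
proof -
  have "finite S" by simp
  then have "\<exists>v. (\<forall>i. coords_in (rat Z) (v i)) \<and> (\<forall>i\<in>S0. v i = u i) \<and> (\<forall>i. \<forall>z\<in>Z. v i z = u i z) \<and>
    (\<forall>t i j. j \<in> nonnbrs E i \<longrightarrow> i \<in> S0 \<union> S \<longrightarrow> j \<in> S0 \<union> S \<longrightarrow> v i t \<bullet> (B t *v v j t) = 0)"
    using perp ind \<open>S0 \<inter> S = {}\<close>
  proof (induction S)
    case empty
    show ?case by (rule exI[of _ u]) (use u perp0 in auto)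
  next
    case (insert k S)
    have "\<exists>v. (\<forall>i. coords_in (rat Z) (v i)) \<and> (\<forall>i\<in>S0. v i = u i) \<and> (\<forall>i. \<forall>z\<in>Z. v i z = u i z) \<and>
      (\<forall>t i j. j \<in> nonnbrs E i \<longrightarrow> i \<in> S0 \<union> S \<longrightarrow> j \<in> S0 \<union> S \<longrightarrow> v i t \<bullet> (B t *v v j t) = 0)"
    proof (rule insert.IH)
      show "lin_indep_on (\<lambda>j. B z *v u j z) (nonnbrs E i \<inter> (S0 \<union> S))" if "z \<in> Z" "i \<in> S" for z i
        by (rule lin_indep_on_mono[OF insert.prems(2)[OF that(1), of i]]) (use that in auto)
      show "u i z \<bullet> (B z *v u j z) = 0"
        if "z \<in> Z" "j \<in> nonnbrs E i" "i \<in> S0 \<union> S" "j \<in> S0 \<union> S" for z i j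
        using insert.prems(1)[OF that(1,2)] that(3,4) by blast
    qed (use insert.prems in auto)
    then obtain v where *: "(\<forall>i. coords_in (rat Z) (v i)) \<and> (\<forall>i\<in>S0. v i = u i) \<and>
      (\<forall>i. \<forall>z\<in>Z. v i z = u i z) \<and>
      (\<forall>t i j. j \<in> nonnbrs E i \<longrightarrow> i \<in> S0 \<union> S \<longrightarrow> j \<in> S0 \<union> S \<longrightarrow> v i t \<bullet> (B t *v v j t) = 0)"
      by (elim exE)
    have v: "\<And>i. coords_in (rat Z) (v i)" "\<And>i. i \<in> S0 \<Longrightarrow> v i = u i"
      "\<And>i z. z \<in> Z \<Longrightarrow> v i z = u i z"
      and vp: "\<And>t i j. j \<in> nonnbrs E i \<Longrightarrow> i \<in> S0 \<union> S \<Longrightarrow> j \<in> S0 \<union> S \<Longrightarrow> v i t \<bullet> (B t *v v j t) = 0"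
      using * by blast+
    \<comment> \<open>Only non-neighbours already placed constrain the new vertex; \<open>k\<close>
      is not a non-neighbour of itself, so no quadratic condition on the new vector arises.\<close>
    let ?T = "nonnbrs E k \<inter> (S0 \<union> S)"
    obtain y where y: "coords_in (rat Z) y" "\<And>z. z \<in> Z \<Longrightarrow> y z = u k z"
      and yp: "\<And>t j. j \<in> ?T \<Longrightarrow> (B t *v v j t) \<bullet> y t = 0"
    proof (rule rat_project[of ?T Z "\<lambda>j t. B t *v v j t" "u k"])
      show "lin_indep_on (\<lambda>j. B z *v v j z) ?T" if "z \<in> Z" for z
        unfolding v(3)[OF that] by (rule lin_indep_on_mono[OF insert.prems(2)[OF that, of k]]) auto
      show "(B z *v v j z) \<bullet> u k z = 0" if "z \<in> Z" "j \<in> ?T" for z j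
        using insert.prems(1)[of z j k] that by (simp add: v(3) inner_commute)
    qed (use u Z rat_matrix_vector_mult[OF B(1) v(1)] in auto)
    have kS: "k \<notin> S0 \<union> S" using insert by auto
    have kk: "k \<notin> nonnbrs E k" by (simp add: nonnbrs_def)
    show ?case
    proof (rule exI[of _ "v(k := y)"], intro conjI allI ballI impI)
      fix t i j assume ij: "j \<in> nonnbrs E i" "i \<in> S0 \<union> insert k S" "j \<in> S0 \<union> insert k S"
      consider "i = k" "j \<in> ?T" | "j = k" "i \<in> ?T" | "i \<in> S0 \<union> S" "j \<in> S0 \<union> S" "i \<noteq> k" "j \<noteq> k"
        using ij kS kk nonnbrs_sym[of j E i] by blast
      then show "(v(k := y)) i t \<bullet> (B t *v (v(k := y)) j t) = 0"
      proof cases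
        case 1
        then have "j \<noteq> k" using kk by blast
        then show ?thesis using 1 yp[of j t] by (simp add: inner_commute)
      next
        case 2
        then have "i \<noteq> k" using kk by blast
        then show ?thesis using 2 yp[of i t] by (simp add: inner_symmetric_matrix[OF B(2)])
      next
        case 3
        then show ?thesis using vp ij(1) by simp
      qed
    qed (use v y kS in auto)
  qed
  then obtain v where *: "(\<forall>i. coords_in (rat Z) (v i)) \<and> (\<forall>i\<in>S0. v i = u i) \<and>
    (\<forall>i. \<forall>z\<in>Z. v i z = u i z) \<and>
    (\<forall>t i j. j \<in> nonnbrs E i \<longrightarrow> i \<in> S0 \<union> S \<longrightarrow> j \<in> S0 \<union> S \<longrightarrow> v i t \<bullet> (B t *v v j t) = 0)"
    by (elim exE)
  show ?thesis by (rule that[of v]) (use * in blast)+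
qed

text \<open>For each basis vector \<open>c\<close>, the vector with entries
  \<open>q i t \<bullet> c\<close> must be orthogonal to the rows of the matrix with columns
  \<open>v i t\<close> indexed by \<open>R\<close>. These rows are independent at times in
  \<open>Z\<close>, so projecting the values of \<open>q0\<close> yields \<open>q\<close>. With
  entries \<open>v i t \<bullet> (B t *v v j t)\<close> the matrix \<open>\<Omega> t\<close> is then
  an equilibrium stress at every time, while minimality of its kernel and local spanning are
  spanning conditions inherited from a point of \<open>Z\<close> by almost all times.\<close>

lemma stress_curve:
  fixes q0 :: "'n::finite \<Rightarrow> real \<Rightarrow> 'e::euclidean_space" and B :: "real \<Rightarrow> real ^ 'n ^ 'n"
  assumes Z: "Z \<noteq> {}" and B: "coords_in (rat Z) B" "\<And>t. transpose (B t) = B t"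
    and BR: "\<And>t k l. k \<notin> R \<Longrightarrow> B t $ k $ l = 0"
    and v: "\<And>i. coords_in (rat Z) (v i)" and q0: "\<And>i. coords_in (rat Z) (q0 i)"
    and perp: "\<And>t i j. j \<in> nonnbrs E i \<Longrightarrow> v i t \<bullet> (B t *v v j t) = 0"
    and fact: "\<And>z. z \<in> Z \<Longrightarrow> factored E R (B z) (\<lambda>i. v i z) (\<lambda>i. q0 i z)"
    and loc: "\<And>z. z \<in> Z \<Longrightarrow> locally_spanning E (\<lambda>i. q0 i z)"
  obtains q where "\<And>i. coords_in (rat Z) (q i)" "\<And>i z. z \<in> Z \<Longrightarrow> q i z = q0 i z"
    "\<And>t k. k \<in> R \<Longrightarrow> (\<Sum>i\<in>UNIV. (v i t $ k) *\<^sub>R q i t) = 0"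
    "\<forall>\<^sub>F t in cofinite. stressed E (\<lambda>i. q i t) \<and> locally_spanning E (\<lambda>i. q i t)"
proof -
  have row_rat: "coords_in (rat Z) (\<lambda>t. \<chi> i. v i t $ k)" for k
    using v rat.coords_vec_nth by (intro rat.coords_vecI) auto
  have "\<exists>y. coords_in (rat Z) y \<and> (\<forall>z\<in>Z. y z = vals (\<lambda>i. q0 i z) c) \<and>
      (\<forall>t. \<forall>k\<in>R. (\<chi> i. v i t $ k) \<bullet> y t = 0)" for c
  proof (rule rat_project[of R Z "\<lambda>k t. \<chi> i. v i t $ k" "\<lambda>t. vals (\<lambda>i. q0 i t) c"])
    show "coords_in (rat Z) (\<lambda>t. vals (\<lambda>i. q0 i t) c)"
      using q0 by (intro rat.coords_vecI) (simp add: rat.coords_real_iff rat.coords_inner_const)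
    show "lin_indep_on (\<lambda>k. \<chi> i. v i z $ k) R" if "z \<in> Z" for z
      using fact[OF that] by (simp add: factored_def)
    show "(\<chi> i. v i z $ k) \<bullet> vals (\<lambda>i. q0 i z) c = 0" if "z \<in> Z" "k \<in> R" for z k
      using fact[OF that(1)] that(2) by (simp add: factored_def inner_vals)
  qed (use row_rat Z in auto)
  then obtain Q where Q: "\<And>c. coords_in (rat Z) (Q c)" "\<And>c z. z \<in> Z \<Longrightarrow> Q c z = vals (\<lambda>i. q0 i z) c"
    "\<And>c t k. k \<in> R \<Longrightarrow> (\<chi> i. v i t $ k) \<bullet> Q c t = 0"
    by metis
  define q where "q = (\<lambda>i t. \<Sum>c\<in>Basis. (Q c t $ i) *\<^sub>R (c :: 'e))"
  have qc: "q i t \<bullet> c = Q c t $ i" if "c \<in> Basis" for i t c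
    using that by (simp add: q_def inner_sum_left inner_Basis if_distrib cong: if_cong)
  have q_rat: "coords_in (rat Z) (q i)" for i
    unfolding coords_in_def
    using rat.coords_vec_nth[OF Q(1)] by (auto simp: qc rat.coords_real_iff)
  have q_z: "q i z = q0 i z" if "z \<in> Z" for i z
    by (rule euclidean_eqI) (simp add: qc Q(2)[OF that])
  have rows: "(\<Sum>i\<in>UNIV. (v i t $ k) *\<^sub>R q i t) = 0" if "k \<in> R" for t k
    by (rule euclidean_eqI) (use Q(3)[OF that, of t] in \<open>simp add: inner_sum_left qc inner_vec_def\<close>)
  define \<Omega> where "\<Omega> = (\<lambda>t. (\<chi> i j. v i t \<bullet> (B t *v v j t)) :: real ^ 'n ^ 'n)"
  have O_rat: "coords_in (rat Z) \<Omega>"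
    using v B(1) unfolding \<Omega>_def
    by (intro rat.coords_vecI)
      (simp add: rat.coords_real_iff rat.coords_inner rat_matrix_vector_mult)
  have O_sym: "transpose (\<Omega> t) = \<Omega> t" for t
  proof -
    have "v i t \<bullet> (B t *v v j t) = v j t \<bullet> (B t *v v i t)" for i j
      unfolding inner_symmetric_matrix[OF B(2), of "v i t"] by (rule inner_commute)
    then show ?thesis unfolding vec_eq_iff transpose_def \<Omega>_def by auto
  qed
  have O_mult: "(\<Omega> t *v x) $ i = v i t \<bullet> (B t *v (\<Sum>j\<in>UNIV. (x $ j) *\<^sub>R v j t))" for t x i
    by (simp add: \<Omega>_def matrix_vector_mult_def[of "\<chi> i j. _ i j"] linear_sum[OF matrix_vector_mul_linear]
        matrix_vector_mult_scaleR inner_sum_right mult.commute)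
  have O_q: "\<Omega> t *v vals (\<lambda>i. q i t) z = 0" for t z
  proof -
    have w0: "(\<Sum>j\<in>UNIV. (vals (\<lambda>i. q i t) z $ j) *\<^sub>R v j t) $ k = 0" if "k \<in> R" for k
      using arg_cong[OF rows[OF that, of t], of "\<lambda>y. y \<bullet> z"] by (simp add: inner_sum_left mult.commute)
    have "B t *v (\<Sum>j\<in>UNIV. (vals (\<lambda>i. q i t) z $ j) *\<^sub>R v j t) = 0"
      by (rule matrix_vector_mult_eq_0_off[where R = R, OF B(2)], erule BR, erule w0)
    then show ?thesis unfolding vec_eq_iff[of "\<Omega> t *v _"] O_mult by simp
  qed
  obtain z where z: "z \<in> Z" using Z by auto
  have qz: "(\<lambda>i. q i z) = (\<lambda>i. q0 i z)" using q_z[OF z] by auto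
  have "spans (stress_system (\<Omega> z) (\<lambda>i. q i z)) (UNIV <+> Basis)"
    unfolding kernel_le_vals_iff[OF O_q, symmetric]
  proof (intro allI impI)
    fix x assume x: "\<Omega> z *v x = 0"
    then have "\<forall>i. v i z \<bullet> (B z *v (\<Sum>j\<in>UNIV. (x $ j) *\<^sub>R v j z)) = 0"
      by (simp add: O_mult[symmetric])
    then show "x \<in> range (vals (\<lambda>i. q i z))"
      using fact[OF z] by (simp add: factored_def qz)
  qed
  moreover have "coords_in (rat Z) (\<lambda>t. stress_system (\<Omega> t) (\<lambda>i. q i t) j)" for j
  proof (cases j)
    case (Inl i)
    then show ?thesis using rat.coords_vec_nth[OF O_rat] by (simp add: stress_system_def)
  next
    case (Inr c)
    have "coords_in (rat Z) (\<lambda>t. vals (\<lambda>i. q i t) c)"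
      by (rule rat.coords_vecI) (simp add: rat.coords_real_iff rat.coords_inner_const q_rat)
    with Inr show ?thesis by (simp add: stress_system_def)
  qed
  ultimately have "\<forall>\<^sub>F t in cofinite. spans (stress_system (\<Omega> t) (\<lambda>i. q i t)) (UNIV <+> Basis)"
    using rat_spans[of "UNIV <+> Basis" Z "\<lambda>j t. stress_system (\<Omega> t) (\<lambda>i. q i t) j" z] z by simp
  moreover have "\<forall>\<^sub>F t in cofinite. locally_spanning E (\<lambda>i. q i t)"
    unfolding locally_spanning_def
  proof (rule eventually_all_finite)
    fix i
    have "spans (\<lambda>i. q i z) (- nonnbrs E i)"
      using loc[OF z] by (simp add: qz locally_spanning_def)
    then show "\<forall>\<^sub>F t in cofinite. spans (\<lambda>i. q i t) (- nonnbrs E i)"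
      using z by (intro rat_spans[where Z = Z]) (auto simp: q_rat)
  qed
  ultimately have "\<forall>\<^sub>F t in cofinite. stressed E (\<lambda>i. q i t) \<and> locally_spanning E (\<lambda>i. q i t)"
  proof eventually_elim
    case (elim t)
    show ?case
      unfolding stressed_def
    proof (intro conjI exI[of _ "\<Omega> t"] elim(2))
      show "\<forall>x. \<Omega> t *v x = 0 \<longrightarrow> x \<in> range (vals (\<lambda>i. q i t))"
        using elim(1) by (simp add: kernel_le_vals_iff[OF O_q])
      show "\<forall>i. \<forall>j\<in>nonnbrs E i. \<Omega> t $ i $ j = 0" using perp by (simp add: \<Omega>_def)
    qed (auto simp: O_sym O_q)
  qed
  then show ?thesis using that q_rat q_z rows by blast
qed

section \<open>Frameworks\<close>

definition homog :: "real ^ 'd ^ 'n \<Rightarrow> 'n \<Rightarrow> (real ^ 'd) \<times> real" where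
  "homog p i = (p $ i, 1)"

lemma aff_dim_eq_iff_spans:
  fixes p :: "real ^ 'd ^ 'n"
  shows "aff_dim (($) p ` S) = int CARD('d) \<longleftrightarrow> spans (homog p) S"
proof
  assume L: "aff_dim (($) p ` S) = int CARD('d)"
  show "spans (homog p) S"
    unfolding spans_def
  proof (intro allI impI)
    fix z assume z: "\<forall>j\<in>S. homog p j \<bullet> z = 0"
    obtain a b where ab: "z = (a, b)" by (cases z)
    have sub: "($) p ` S \<subseteq> {x. a \<bullet> x = - b}"
      using z by (auto simp: ab homog_def inner_commute[of a] eq_neg_iff_add_eq_0)
    have "a = 0"
    proof (rule ccontr)
      assume "a \<noteq> 0"
      then have "aff_dim {x. a \<bullet> x = - b} = int CARD('d) - 1" by (simp add: aff_dim_hyperplane)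
      then show False using aff_dim_subset[OF sub] L by simp
    qed
    \<comment> \<open>A point of the framework is needed to pass from \<open>a = 0\<close> to
      \<open>b = 0\<close>; the empty set is excluded by its affine dimension
      \<open>-1\<close>.\<close>
    moreover have "S \<noteq> {}" using L by auto
    then have "b = 0" using sub \<open>a = 0\<close> by auto
    ultimately show "z = 0" by (simp add: ab zero_prod_def)
  qed
next
  assume R: "spans (homog p) S"
  show "aff_dim (($) p ` S) = int CARD('d)"
  proof (rule ccontr)
    assume "aff_dim (($) p ` S) \<noteq> int CARD('d)"
    then have "aff_dim (($) p ` S) < int DIM(real ^ 'd)"
      using aff_dim_le_DIM[of "($) p ` S"] by simp
    then obtain a b where ab: "a \<noteq> 0" "($) p ` S \<subseteq> {x. a \<bullet> x = b}"
      by (rule aff_lowdim_subset_hyperplane)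
    then have "\<forall>j\<in>S. homog p j \<bullet> (a, - b) = 0" by (auto simp: homog_def inner_commute)
    then have "(a, - b) = 0" using R unfolding spans_def by blast
    then show False using ab(1) by (simp add: zero_prod_def)
  qed
qed

lemma aff_dim_union_finite_le:
  assumes "finite B"
  shows "aff_dim (A \<union> B) \<le> aff_dim A + int (card B)"
  using assms
proof (induction B)
  case (insert b B)
  have "aff_dim (A \<union> insert b B) \<le> aff_dim (A \<union> B) + 1"
    using aff_dim_insert[of b "A \<union> B"] by simp
  then show ?case using insert by simp
qed simp

text \<open>A smaller degenerate \<open>K\<close> extends to a degenerate set of
  \<open>d + 1\<close> vertices: each added point raises the affine dimension by at most one, so it
  stays below \<open>d\<close>. In the other direction, \<open>d + 1\<close> points without full
  affine span lie on a hyperplane, whose dimension is \<open>d - 1\<close>.\<close>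

lemma affine_general_position_iff:
  fixes p :: "real ^ 'd ^ 'n"
  assumes "CARD('n) \<ge> CARD('d) + 1"
  shows "affine_general_position p \<longleftrightarrow> (\<forall>K. card K = CARD('d) + 1 \<longrightarrow> spans (homog p) K)"
proof
  assume L: "affine_general_position p"
  show "\<forall>K. card K = CARD('d) + 1 \<longrightarrow> spans (homog p) K"
  proof (intro allI impI)
    fix K :: "'n set" assume K: "card K = CARD('d) + 1"
    show "spans (homog p) K"
      unfolding aff_dim_eq_iff_spans[symmetric]
    proof (rule ccontr)
      assume "aff_dim (($) p ` K) \<noteq> int CARD('d)"
      then have "aff_dim (($) p ` K) < int DIM(real ^ 'd)"
        using aff_dim_le_DIM[of "($) p ` K"] by simp
      then obtain a b where ab: "a \<noteq> 0" "($) p ` K \<subseteq> {x. a \<bullet> x = b}"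
        by (rule aff_lowdim_subset_hyperplane)
      have "affine {x. a \<bullet> x = b}" by (rule affine_hyperplane)
      moreover have "aff_dim {x. a \<bullet> x = b} = int (card K) - 2" using ab(1) K by (simp add: aff_dim_hyperplane)
      ultimately show False
        using L K ab(2) unfolding affine_general_position_def by (metis image_subset_iff le_refl)
    qed
  qed
next
  assume R: "\<forall>K. card K = CARD('d) + 1 \<longrightarrow> spans (homog p) K"
  show "affine_general_position p"
    unfolding affine_general_position_def
  proof (intro allI impI notI, elim exE conjE)
    fix K and A :: "(real ^ 'd) set"
    assume K: "card K \<le> CARD('d) + 1" and A: "aff_dim A = int (card K) - 2" "\<forall>i\<in>K. p $ i \<in> A"
    obtain K' where K': "K \<subseteq> K'" "card K' = CARD('d) + 1"
      using exists_subset_between[of K "CARD('d) + 1" UNIV] K assms by auto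
    have "($) p ` K' \<subseteq> A \<union> ($) p ` (K' - K)" using A(2) by auto
    then have "aff_dim (($) p ` K') \<le> aff_dim (A \<union> ($) p ` (K' - K))" by (rule aff_dim_subset)
    also have "\<dots> \<le> aff_dim A + int (card (($) p ` (K' - K)))" by (intro aff_dim_union_finite_le) simp
    also have "\<dots> \<le> aff_dim A + int (card (K' - K))" by (simp add: card_image_le)
    also have "card (K' - K) = CARD('d) + 1 - card K" using K' by (simp add: card_Diff_subset)
    finally have "aff_dim (($) p ` K') < int CARD('d)" using A(1) K by simp
    then show False using R K' aff_dim_eq_iff_spans[of p K'] by simp
  qed
qed

section \<open>Rank and kernel of stress matrices\<close>

lemma rank_plus_dim_kernel:
  fixes \<Omega> :: "real ^ 'n ^ 'n"
  shows "rank \<Omega> + dim {x. \<Omega> *v x = 0} = CARD('n)"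
proof -
  have "{y \<in> UNIV. \<forall>x\<in>span (rows \<Omega>). orthogonal x y} = {x. \<Omega> *v x = 0}"
  proof (intro set_eqI iffI)
    fix y assume "y \<in> {y \<in> UNIV. \<forall>x\<in>span (rows \<Omega>). orthogonal x y}"
    then have "row i \<Omega> \<bullet> y = 0" for i
      by (auto simp: orthogonal_def rows_def intro: span_base)
    then show "y \<in> {x. \<Omega> *v x = 0}" by (simp add: vec_eq_iff matrix_vector_mul_component row_def)
  next
    fix y assume "y \<in> {x. \<Omega> *v x = 0}"
    then have y: "row i \<Omega> \<bullet> y = 0" for i
      by (simp add: vec_eq_iff matrix_vector_mul_component row_def)
    have "orthogonal y x" if "x \<in> span (rows \<Omega>)" for x
      by (rule orthogonal_to_span[OF that]) (use y in \<open>auto simp: rows_def orthogonal_def inner_commute\<close>)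
    then show "y \<in> {y \<in> UNIV. \<forall>x\<in>span (rows \<Omega>). orthogonal x y}"
      by (simp add: orthogonal_commute)
  qed
  then show ?thesis
    using dim_subspace_orthogonal_to_vectors[of "span (rows \<Omega>)" UNIV]
    by (simp add: row_rank_def add.commute)
qed

text \<open>Spanning makes \<open>vals q\<close> injective, so its range is a subspace of the kernel
  of dimension \<open>DIM('e)\<close>; the rank condition says that the dimensions agree.\<close>

lemma rank_eq_iff_kernel:
  fixes q :: "'n::finite \<Rightarrow> 'e::euclidean_space" and \<Omega> :: "real ^ 'n ^ 'n"
  assumes "\<And>z. \<Omega> *v vals q z = 0" "spans q UNIV"
  shows "rank \<Omega> + DIM('e) = CARD('n) \<longleftrightarrow> (\<forall>x. \<Omega> *v x = 0 \<longrightarrow> x \<in> range (vals q))"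
proof -
  have "inj (vals q)"
    using assms(2) by (auto simp: linear_injective_0[OF linear_vals] spans_def vec_eq_iff)
  then have dimA: "dim (range (vals q)) = DIM('e)"
    using dim_image_eq[OF linear_vals, of q UNIV] by simp
  have sub: "subspace (range (vals q))" "subspace {x. \<Omega> *v x = 0}"
    using linear_subspace_image[OF linear_vals subspace_UNIV]
      linear_subspace_kernel[OF matrix_vector_mul_linear] by auto
  have le: "range (vals q) \<subseteq> {x. \<Omega> *v x = 0}" using assms(1) by auto
  have "rank \<Omega> + DIM('e) = CARD('n) \<longleftrightarrow> dim (range (vals q)) = dim {x. \<Omega> *v x = 0}"
    using rank_plus_dim_kernel[of \<Omega>] dimA by linarith
  also have "\<dots> \<longleftrightarrow> range (vals q) = {x. \<Omega> *v x = 0}"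
    by (rule iffI, rule subspace_dim_equal[OF sub le]) simp_all
  finally show ?thesis using le by blast
qed

lemma equilibrium_iff_homog:
  fixes p :: "real ^ 'd ^ 'n" and \<Omega> :: "real ^ 'n ^ 'n"
  shows "\<Omega> *v vec 1 = 0 \<and> (\<forall>i. (\<Sum>j\<in>UNIV. (\<Omega> $ i $ j) *\<^sub>R (p $ j)) = 0) \<longleftrightarrow>
    (\<forall>z. \<Omega> *v vals (homog p) z = 0)"
proof -
  have "\<Omega> *v vec 1 = 0 \<longleftrightarrow> (\<forall>i. (\<Sum>j\<in>UNIV. \<Omega> $ i $ j) = 0)"
    by (simp add: vec_eq_iff matrix_vector_mult_def)
  moreover have "(\<Sum>j\<in>UNIV. (\<Omega> $ i $ j) *\<^sub>R homog p j) =
      (\<Sum>j\<in>UNIV. (\<Omega> $ i $ j) *\<^sub>R (p $ j), \<Sum>j\<in>UNIV. \<Omega> $ i $ j)" for i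
    by (simp add: homog_def prod_eq_iff fst_sum snd_sum)
  ultimately show ?thesis
    unfolding stress_vals_iff[symmetric] by (auto simp: zero_prod_def)
qed

lemma has_max_rank_stress_iff:
  fixes p :: "real ^ 'd ^ 'n"
  assumes "spans (homog p) UNIV"
  shows "has_max_rank_stress E p \<longleftrightarrow> stressed E (homog p)"
proof -
  have "(equilibrium_stress_matrix E p \<Omega> \<and> rank \<Omega> + CARD('d) + 1 = CARD('n)) \<longleftrightarrow>
    transpose \<Omega> = \<Omega> \<and> (\<forall>i. \<forall>j\<in>nonnbrs E i. \<Omega> $ i $ j = 0) \<and>
     (\<forall>z. \<Omega> *v vals (homog p) z = 0) \<and> (\<forall>x. \<Omega> *v x = 0 \<longrightarrow> x \<in> range (vals (homog p)))" for \<Omega>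
  proof -
    have "equilibrium_stress_matrix E p \<Omega> \<longleftrightarrow>
       transpose \<Omega> = \<Omega> \<and> (\<forall>i. \<forall>j\<in>nonnbrs E i. \<Omega> $ i $ j = 0) \<and> (\<forall>z. \<Omega> *v vals (homog p) z = 0)"
      unfolding equilibrium_stress_matrix_def equilibrium_iff_homog[symmetric]
      by (auto simp: nonnbrs_def)
    moreover have "rank \<Omega> + CARD('d) + 1 = CARD('n) \<longleftrightarrow>
        (\<forall>x. \<Omega> *v x = 0 \<longrightarrow> x \<in> range (vals (homog p)))" if "\<forall>z. \<Omega> *v vals (homog p) z = 0"
      using rank_eq_iff_kernel[of \<Omega> "homog p"] that assms by simp
    ultimately show ?thesis by blast
  qed
  then show ?thesis unfolding has_max_rank_stress_def stressed_def by simp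
qed

lemma Fstressable_iff:
  fixes p :: "real ^ 'd ^ 'n"
  shows "Fstressable E p \<longleftrightarrow> stressed E (homog p) \<and> locally_spanning E (homog p)"
proof -
  have "insert (p $ i) {p $ j |j. {i, j} \<in> E} = ($) p ` (- nonnbrs E i)" for i
    by (auto simp: nonnbrs_def)
  then have "(\<forall>i. aff_dim (insert (p $ i) {p $ j | j. {i, j} \<in> E}) = int CARD('d)) \<longleftrightarrow>
      locally_spanning E (homog p)"
    by (simp add: aff_dim_eq_iff_spans locally_spanning_def)
  then show ?thesis
    unfolding Fstressable_def
    using has_max_rank_stress_iff locally_spanning_imp_spans by blast
qed

text \<open>The point is that general position forces local spanning. A closed neighbourhood that
  does not span has at most \<open>d + 1\<close> vertices, so its homogeneous vectors are
  independent and equilibrium at \<open>i\<close> makes the whole row \<open>i\<close> of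
  \<open>\<Omega>\<close> zero. By symmetry \<open>axis i 1\<close> is then a kernel vector, yet no
  nonzero vector of the form \<open>vals (homog p) z\<close> can vanish at \<open>d + 1\<close>
  vertices.\<close>

lemma Gstressable_iff:
  fixes p :: "real ^ 'd ^ 'n"
  assumes n: "CARD('n) \<ge> CARD('d) + 2"
  shows "Gstressable E p \<longleftrightarrow> Fstressable E p \<and> (\<forall>K. card K = CARD('d) + 1 \<longrightarrow> spans (homog p) K)"
proof -
  have gp: "affine_general_position p \<longleftrightarrow> (\<forall>K. card K = CARD('d) + 1 \<longrightarrow> spans (homog p) K)"
    using n by (intro affine_general_position_iff) simp
  have "locally_spanning E (homog p) \<and> stressed E (homog p)"
    if K: "\<And>K. card K = CARD('d) + 1 \<Longrightarrow> spans (homog p) K" and "has_max_rank_stress E p"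
  proof -
    obtain K0 :: "'n set" where "card K0 = CARD('d) + 1"
      using obtain_subset_with_card_n[of "CARD('d) + 1" "UNIV :: 'n set"] n by auto
    then have sp: "spans (homog p) UNIV" using K spans_mono by blast
    then have st: "stressed E (homog p)" using that(2) has_max_rank_stress_iff by blast
    then obtain \<Omega> :: "real ^ 'n ^ 'n" where \<Omega>: "transpose \<Omega> = \<Omega> \<and>
       (\<forall>i. \<forall>j\<in>nonnbrs E i. \<Omega> $ i $ j = 0) \<and> (\<forall>z. \<Omega> *v vals (homog p) z = 0) \<and>
       (\<forall>x. \<Omega> *v x = 0 \<longrightarrow> x \<in> range (vals (homog p)))"
      unfolding stressed_def by (elim exE)
    have "spans (homog p) (- nonnbrs E i)" for i
    proof (rule ccontr)
      let ?N = "- nonnbrs E i"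
      assume ns: "\<not> spans (homog p) ?N"
      have "card ?N \<le> CARD('d) + 1"
      proof (rule ccontr)
        assume "\<not> card ?N \<le> CARD('d) + 1"
        then obtain K' where "K' \<subseteq> ?N" "card K' = CARD('d) + 1"
          using obtain_subset_with_card_n[of "CARD('d) + 1" ?N] by (metis nat_le_linear)
        then show False using K ns spans_mono by blast
      qed
      then obtain K1 where K1: "?N \<subseteq> K1" "card K1 = CARD('d) + 1"
        using exists_subset_between[of ?N "CARD('d) + 1" UNIV] n by auto
      have "lin_indep_on (homog p) K1"
        using K1 K by (intro spans_imp_lin_indep_on) auto
      then have ind: "lin_indep_on (homog p) ?N" using K1(1) by (rule lin_indep_on_mono)
      have "(\<Sum>j\<in>?N. (\<Omega> $ i $ j) *\<^sub>R homog p j) = (\<Sum>j\<in>UNIV. (\<Omega> $ i $ j) *\<^sub>R homog p j)"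
        using \<Omega> by (intro sum.mono_neutral_left) auto
      also have "\<dots> = 0" using \<Omega> stress_vals_iff[of \<Omega> "homog p"] by blast
      finally have "\<forall>j\<in>?N. \<Omega> $ i $ j = 0" using ind unfolding lin_indep_on_iff[OF finite] by blast
      then have row0: "\<Omega> $ i $ j = 0" for j using \<Omega> by blast
      have "\<Omega> *v axis i 1 = 0"
        using \<Omega> row0 unfolding matrix_vector_mult_basis column_def transpose_def vec_eq_iff
        by auto
      then obtain z where z: "axis i 1 = vals (homog p) z" using \<Omega> by blast
      \<comment> \<open>Here \<open>n \<ge> d + 2\<close> enters: \<open>d + 1\<close> vertices are
        left after removing \<open>i\<close>.\<close>
      have "CARD('d) + 1 \<le> card (UNIV - {i})" using n by (simp add: card_Diff_singleton)
      then obtain K2 where K2: "K2 \<subseteq> UNIV - {i}" "card K2 = CARD('d) + 1"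
        by (rule obtain_subset_with_card_n)
      have "\<forall>j\<in>K2. homog p j \<bullet> z = 0"
      proof
        fix j assume "j \<in> K2"
        with K2(1) have "j \<noteq> i" by blast
        then show "homog p j \<bullet> z = 0"
          using arg_cong[OF z, of "\<lambda>x. x $ j"] by (simp add: axis_def)
      qed
      then have "z = 0" using K[OF K2(2)] unfolding spans_def by blast
      then have "axis i 1 = (0 :: real ^ 'n)" using z by (simp add: vec_eq_iff)
      then show False by (simp add: axis_eq_0_iff)
    qed
    then show ?thesis using st by (simp add: locally_spanning_def)
  qed
  then show ?thesis
    unfolding Gstressable_def gp Fstressable_iff
    using has_max_rank_stress_iff locally_spanning_imp_spans by blast
qed

section \<open>Rescaling the homogeneous vectors\<close>

lemma spans_scale:
  assumes "\<And>i. s i \<noteq> 0"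
  shows "spans (\<lambda>i. s i *\<^sub>R q i) S \<longleftrightarrow> spans q S"
  using assms by (simp add: spans_def)

text \<open>Multiply \<open>\<Omega>\<close> on both sides by the diagonal matrix with entries
  \<open>1 / s i\<close>. This keeps symmetry and the zero pattern, and kernel vectors are rescaled
  entrywise by \<open>s\<close>, exactly as \<open>vals\<close> is.\<close>

lemma stressed_scale:
  assumes "stressed E q" and s: "\<And>i. s i \<noteq> 0"
  shows "stressed E (\<lambda>i. s i *\<^sub>R q i)"
proof -
  obtain \<Omega> :: "real ^ 'a ^ 'a" where \<Omega>: "transpose \<Omega> = \<Omega> \<and>
     (\<forall>i. \<forall>j\<in>nonnbrs E i. \<Omega> $ i $ j = 0) \<and> (\<forall>z. \<Omega> *v vals q z = 0) \<and>
     (\<forall>x. \<Omega> *v x = 0 \<longrightarrow> x \<in> range (vals q))"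
    using assms(1) unfolding stressed_def by (elim exE)
  define \<Omega>' where "\<Omega>' = ((\<chi> i j. \<Omega> $ i $ j / (s i * s j)) :: real ^ 'a ^ 'a)"
  have mult: "(\<Omega>' *v x) $ i = (\<Omega> *v (\<chi> j. x $ j / s j)) $ i / s i" for x i
    by (simp add: \<Omega>'_def matrix_vector_mult_def sum_divide_distrib mult_ac)
  have vals: "(\<chi> j. vals (\<lambda>i. s i *\<^sub>R q i) z $ j / s j) = vals q z" for z
    using s by (simp add: vec_eq_iff)
  show ?thesis
    unfolding stressed_def
  proof (rule exI[of _ \<Omega>'], intro conjI allI ballI impI)
    have "\<Omega> $ j $ i = \<Omega> $ i $ j" for i j
      using \<Omega> by (metis transpose_def vec_lambda_beta)
    then show "transpose \<Omega>' = \<Omega>'"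
      by (simp add: \<Omega>'_def transpose_def vec_eq_iff mult.commute)
    show "\<Omega>' $ i $ j = 0" if "j \<in> nonnbrs E i" for i j using \<Omega> that by (simp add: \<Omega>'_def)
    show "\<Omega>' *v vals (\<lambda>i. s i *\<^sub>R q i) z = 0" for z
      using \<Omega> by (simp add: vec_eq_iff[of "\<Omega>' *v _"] mult vals del: vals_nth)
  next
    fix x assume "\<Omega>' *v x = 0"
    then have "(\<Omega> *v (\<chi> j. x $ j / s j)) $ i / s i = 0" for i by (metis mult zero_index)
    then have "\<Omega> *v (\<chi> j. x $ j / s j) = 0" using s by (simp add: vec_eq_iff)
    then obtain z where z: "(\<chi> j. x $ j / s j) = vals q z" using \<Omega> by blast
    have "x $ j = s j * (q j \<bullet> z)" for j
      using arg_cong[OF z, of "\<lambda>y. y $ j"] s[of j] by (simp add: field_simps)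
    then have "x = vals (\<lambda>i. s i *\<^sub>R q i) z" by (simp add: vec_eq_iff)
    then show "x \<in> range (vals (\<lambda>i. s i *\<^sub>R q i))" by blast
  qed
qed

section \<open>Rational curves of Fstressable frameworks\<close>

context function_algebra
begin

lemma coords_fst: "coords_in \<A> f \<Longrightarrow> coords_in \<A> (\<lambda>x. fst (f x))"
  using coords_inner_const[of f "(_, 0)"] by (auto simp: coords_in_def inner_prod_def)

lemma coords_snd: "coords_in \<A> f \<Longrightarrow> coords_in \<A> (\<lambda>x. snd (f x))"
  using coords_inner_const[of f "(0, _)"] by (auto simp: coords_in_def inner_prod_def)

lemma coords_Pair:
  assumes "coords_in \<A> f" "coords_in \<A> g"
  shows "coords_in \<A> (\<lambda>x. (f x, g x))"
  unfolding coords_in_def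
proof
  fix b :: "'a \<times> 'b"
  have "(\<lambda>x. f x \<bullet> fst b + g x \<bullet> snd b) \<in> \<A>"
    using assms by (intro add coords_inner_const)
  then show "(\<lambda>x. (f x, g x) \<bullet> b) \<in> \<A>" by (simp add: inner_prod_def)
qed

lemma coords_homog: "coords_in \<A> c \<Longrightarrow> coords_in \<A> (\<lambda>x. homog (c x) i)"
  unfolding homog_def by (intro coords_Pair coords_vec_nth) auto

end

lemma rat_line: "coords_in (rat Z) (\<lambda>t. (1 - t) *\<^sub>R x + t *\<^sub>R y)"
  by (intro rat.coords_add rat.coords_scaleR rat.coords_const rat.diff rat.const rat_id)

lemma rat_spans_homog:
  assumes "coords_in (rat Z) c" "z \<in> Z" "spans (homog (c z)) K"
  shows "\<forall>\<^sub>F t in cofinite. spans (homog (c t)) K"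
  using rat_spans[where q = "\<lambda>i t. homog (c t) i"] assms rat.coords_homog by blast

text \<open>The last coordinates equal 1 on \<open>Z\<close>, so dividing by them stays in
  \<open>rat Z\<close> and leaves the points at times in \<open>Z\<close> unchanged. At almost all
  times none of them is zero, and there stresses and spanning survive the rescaling.\<close>

lemma normalise_curve:
  fixes q :: "'n::finite \<Rightarrow> real \<Rightarrow> (real ^ 'd) \<times> real"
  assumes Z: "Z \<noteq> {}" and q: "\<And>i. coords_in (rat Z) (q i)"
    and one: "\<And>i z. z \<in> Z \<Longrightarrow> snd (q i z) = 1"
    and gen: "\<forall>\<^sub>F t in cofinite. stressed E (\<lambda>i. q i t) \<and> locally_spanning E (\<lambda>i. q i t)"
  obtains c where "coords_in (rat Z) c" "\<And>z. z \<in> Z \<Longrightarrow> c z = (\<chi> i. fst (q i z))"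
    "\<forall>\<^sub>F t in cofinite. Fstressable E (c t) \<and> (\<forall>K. spans (\<lambda>i. q i t) K \<longrightarrow> spans (homog (c t)) K)"
proof
  define c where "c = (\<lambda>t. \<chi> i. (1 / snd (q i t)) *\<^sub>R fst (q i t))"
  have snd_rat: "(\<lambda>t. snd (q i t)) \<in> rat Z" for i
    using rat.coords_snd[OF q] by (simp add: rat.coords_real_iff)
  show "coords_in (rat Z) c"
    unfolding c_def
  proof (rule rat.coords_vecI)
    fix i
    have "coords_in (rat Z) (\<lambda>t. (1 / snd (q i t)) *\<^sub>R fst (q i t))"
      using Z one by (intro rat.coords_scaleR rat_inverse rat.coords_fst q snd_rat) auto
    then show "coords_in (rat Z) (\<lambda>t. (\<chi> i. (1 / snd (q i t)) *\<^sub>R fst (q i t)) $ i)" by simp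
  qed
  show "c z = (\<chi> i. fst (q i z))" if "z \<in> Z" for z
    by (simp add: c_def one[OF that])
  obtain z where z: "z \<in> Z" using Z by auto
  have "\<forall>\<^sub>F t in cofinite. \<forall>i. snd (q i t) \<noteq> 0"
    by (intro eventually_all_finite rat_nonzero_cofinite[OF snd_rat z]) (simp add: one[OF z])
  with gen show "\<forall>\<^sub>F t in cofinite. Fstressable E (c t) \<and> (\<forall>K. spans (\<lambda>i. q i t) K \<longrightarrow> spans (homog (c t)) K)"
  proof eventually_elim
    case (elim t)
    let ?s = "\<lambda>i. 1 / snd (q i t)"
    have h: "homog (c t) = (\<lambda>i. ?s i *\<^sub>R q i t)"
      using elim(2) by (auto simp: homog_def c_def prod_eq_iff)
    have s: "?s i \<noteq> 0" for i using elim(2) by simp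
    have "stressed E (homog (c t))" unfolding h using elim(1) s by (intro stressed_scale) auto
    moreover have "spans (homog (c t)) K \<longleftrightarrow> spans (\<lambda>i. q i t) K" for K
      unfolding h using s by (rule spans_scale)
    ultimately show ?case using elim(1) by (simp add: Fstressable_iff locally_spanning_def)
  qed
qed

lemma Fstressable_imp_factored:
  fixes p :: "real ^ 'd ^ 'n"
  assumes "Fstressable E p" "card R + CARD('d) + 1 = CARD('n)"
  obtains B v where "factored E R B v (homog p)"
proof (rule stressed_imp_factored[of E "homog p" R])
  show "stressed E (homog p)" "spans (homog p) UNIV"
    using assms(1) locally_spanning_imp_spans by (auto simp: Fstressable_iff)
qed (use assms(2) in auto)

lemma obtain_subset_with_codim:
  assumes "CARD('n) \<ge> CARD('d) + 2"
  obtains R :: "'n::finite set" where "card R + CARD('d) + 1 = CARD('n)"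
proof -
  have "CARD('n) - (CARD('d) + 1) \<le> card (UNIV :: 'n set)" by simp
  then obtain R :: "'n set" where "card R = CARD('n) - (CARD('d) + 1)"
    by (rule obtain_subset_with_card_n)
  then show ?thesis using assms by (intro that[of R]) simp
qed

text \<open>The matrices \<open>B\<close> may be interpolated freely, since symmetric matrices with
  rows supported on \<open>R\<close> form a linear space. The straight lines \<open>u\<close> and
  \<open>q0\<close> violate the orthogonality and row conditions between the endpoints; the two
  projections repair this and fix both endpoints.\<close>

lemma Fstressable_curve:
  fixes p p' :: "real ^ 'd ^ 'n"
  assumes n: "CARD('n) \<ge> CARD('d) + 2" and p: "Fstressable E p" and p': "Fstressable E p'"
  obtains c where "coords_in (rat {0, 1}) c" "c 0 = p" "c 1 = p'"
    "\<forall>\<^sub>F t in cofinite. Fstressable E (c t)"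
proof -
  obtain R :: "'n set" where R: "card R + CARD('d) + 1 = CARD('n)"
    by (rule obtain_subset_with_codim[OF n])
  obtain B0 v0 where f0: "factored E R B0 v0 (homog p)"
    by (rule Fstressable_imp_factored[OF p R])
  obtain B1 v1 where f1: "factored E R B1 v1 (homog p')"
    by (rule Fstressable_imp_factored[OF p' R])
  let ?Z = "{0, 1 :: real}"
  define B where "B = (\<lambda>t. (1 - t) *\<^sub>R B0 + t *\<^sub>R B1)"
  define u where "u = (\<lambda>i t. (1 - t) *\<^sub>R v0 i + t *\<^sub>R v1 i)"
  define q0 where "q0 = (\<lambda>i t. (1 - t) *\<^sub>R homog p i + t *\<^sub>R homog p' i)"
  define P where "P = (\<lambda>t::real. if t = 0 then p else p')"
  have fact: "factored E R (B z) (\<lambda>i. u i z) (\<lambda>i. q0 i z)" if "z \<in> ?Z" for z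
    using that f0 f1 by (auto simp: B_def u_def q0_def)
  have q0P: "(\<lambda>i. q0 i z) = homog (P z)" if "z \<in> ?Z" for z using that by (auto simp: q0_def P_def)
  have loc: "locally_spanning E (\<lambda>i. q0 i z)" if "z \<in> ?Z" for z
    unfolding q0P[OF that] using p p' by (simp add: P_def Fstressable_iff)
  have Brat: "coords_in (rat ?Z) B" unfolding B_def by (rule rat_line)
  have Bsym: "transpose (B t) = B t" for t
    using f0 f1 by (simp add: B_def factored_def transpose_def vec_eq_iff)
  have BR: "B t $ k $ l = 0" if "k \<notin> R" for t k l
    using f0 f1 that by (simp add: B_def factored_def)
  obtain v where v: "\<And>i. coords_in (rat ?Z) (v i)"
    and vz: "\<And>i z. z \<in> ?Z \<Longrightarrow> v i z = u i z"
    and vperp: "\<And>t i j. j \<in> nonnbrs E i \<Longrightarrow> v i t \<bullet> (B t *v v j t) = 0"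
  proof (rule extend_vertices[of ?Z B u E "{}" UNIV])
    show "coords_in (rat ?Z) (u i)" for i unfolding u_def by (rule rat_line)
    show "u i z \<bullet> (B z *v u j z) = 0" if "z \<in> ?Z" "j \<in> nonnbrs E i" for z i j
      using fact[OF that(1)] that(2) by (simp add: factored_def)
    show "lin_indep_on (\<lambda>j. B z *v u j z) (nonnbrs E i \<inter> ({} \<union> UNIV))" if "z \<in> ?Z" for z i
      using factored_imp_lin_indep_on[OF fact[OF that], of "nonnbrs E i"] loc[OF that]
      by (simp add: locally_spanning_def)
  qed (use Brat Bsym in auto)
  have fact': "factored E R (B z) (\<lambda>i. v i z) (\<lambda>i. q0 i z)" if "z \<in> ?Z" for z
    using fact[OF that] by (simp add: vz[OF that])
  obtain q where q: "\<And>i. coords_in (rat ?Z) (q i)" and qz: "\<And>i z. z \<in> ?Z \<Longrightarrow> q i z = q0 i z"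
    and gen: "\<forall>\<^sub>F t in cofinite. stressed E (\<lambda>i. q i t) \<and> locally_spanning E (\<lambda>i. q i t)"
  proof (rule stress_curve[of ?Z B R v q0 E])
    show "coords_in (rat ?Z) (q0 i)" for i unfolding q0_def by (rule rat_line)
  qed (use Brat Bsym BR v vperp fact' loc in auto)
  have qP: "q i z = homog (P z) i" if "z \<in> ?Z" for i z
    using qz[OF that] q0P[OF that] by metis
  obtain c where c: "coords_in (rat ?Z) c" and cz: "\<And>z. z \<in> ?Z \<Longrightarrow> c z = (\<chi> i. fst (q i z))"
    and cF: "\<forall>\<^sub>F t in cofinite. Fstressable E (c t) \<and> (\<forall>K. spans (\<lambda>i. q i t) K \<longrightarrow> spans (homog (c t)) K)"
    by (rule normalise_curve[of ?Z q E]) (use q gen in \<open>auto simp: qP homog_def\<close>)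
  show ?thesis
  proof (rule that[OF c])
    show "c 0 = p" "c 1 = p'" using cz[of 0] cz[of 1] by (simp_all add: qP homog_def P_def vec_eq_iff)
    show "\<forall>\<^sub>F t in cofinite. Fstressable E (c t)" using cF by (rule eventually_mono) simp
  qed
qed

lemma lin_indep_on_axis:
  assumes "inj_on \<sigma> T"
  shows "lin_indep_on (\<lambda>j. axis (\<sigma> j) 1 :: real ^ 'n) T"
  unfolding lin_indep_on_def
proof
  show "inj_on (\<lambda>j. axis (\<sigma> j) 1 :: real ^ 'n) T"
    using assms by (auto simp: inj_on_def axis_eq_axis)
  show "independent ((\<lambda>j. axis (\<sigma> j) 1 :: real ^ 'n) ` T)"
    by (rule independent_mono[OF independent_Basis]) (auto simp: Basis_vec_def)
qed

text \<open>The vertices outside \<open>K\<close> come first in the construction order. No nonedge constrains an orthonormal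
  choice of their vectors, so the construction may pass through such a choice at time \<open>1\<close>.\<close>

lemma Fstressable_spanning_exists:
  fixes p :: "real ^ 'd ^ 'n"
  assumes n: "CARD('n) \<ge> CARD('d) + 2" and p: "Fstressable E p" and K: "card K = CARD('d) + 1"
  obtains p' :: "real ^ 'd ^ 'n" where "Fstressable E p'" "spans (homog p') K"
proof -
  obtain R :: "'n set" where R: "card R + CARD('d) + 1 = CARD('n)"
    by (rule obtain_subset_with_codim[OF n])
  obtain B0 v0 where f0: "factored E R B0 v0 (homog p)"
    by (rule Fstressable_imp_factored[OF p R])
  have loc: "locally_spanning E (homog p)" using p by (simp add: Fstressable_iff)
  have "card (- K) = card R" using R K card_Un_disjoint[of K "- K"] by (simp add: Compl_partition)
  then obtain \<sigma> where \<sigma>: "bij_betw \<sigma> (- K) R" using finite_same_card_bij[of "- K" R] by auto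
  \<comment> \<open>The identity on the entries in \<open>R\<close>: the form for which the axis
    vectors given by \<open>\<sigma>\<close> are orthonormal. It is the value of \<open>B\<close> at
    time 1.\<close>
  define I where "I = ((\<chi> k l. if k = l \<and> k \<in> R then 1 else 0) :: real ^ 'n ^ 'n)"
  have Iaxis: "I *v axis k 1 = axis k 1" if "k \<in> R" for k
    unfolding matrix_vector_mult_basis using that by (auto simp: I_def vec_eq_iff axis_def column_def)
  define B where "B = (\<lambda>t. (1 - t) *\<^sub>R B0 + t *\<^sub>R I)"
  define u where "u = (\<lambda>i t. (1 - t) *\<^sub>R v0 i + t *\<^sub>R (axis (\<sigma> i) 1 :: real ^ 'n))"
  have Brat: "coords_in (rat Z) B" for Z unfolding B_def by (rule rat_line)
  have u_rat: "coords_in (rat Z) (u i)" for Z i unfolding u_def by (rule rat_line)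
  have Bsym: "transpose (B t) = B t" for t
    using f0 by (auto simp: B_def factored_def transpose_def vec_eq_iff I_def)
  have BR: "B t $ k $ l = 0" if "k \<notin> R" for t k l
    using f0 that by (auto simp: B_def factored_def I_def)
  have B1: "B 1 *v u j 1 = axis (\<sigma> j) 1" if "j \<in> - K" for j
    using that \<sigma> Iaxis[of "\<sigma> j"] by (auto simp: B_def u_def bij_betw_def)
  have inj: "inj_on \<sigma> (- K)" using \<sigma> by (simp add: bij_betw_def)
  have ind0: "lin_indep_on (\<lambda>j. B 0 *v v0 j) (nonnbrs E i)" for i
    using factored_imp_lin_indep_on[OF f0, of "nonnbrs E i"] loc
    by (simp add: locally_spanning_def B_def)
  have perp0: "v0 i \<bullet> (B 0 *v v0 j) = 0" if "j \<in> nonnbrs E i" for i j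
    using f0 that by (simp add: B_def factored_def)
  have ind1: "lin_indep_on (\<lambda>j. B 1 *v u j 1) T" if "T \<subseteq> - K" for T
  proof -
    have "lin_indep_on (\<lambda>j. axis (\<sigma> j) 1 :: real ^ 'n) T"
      using inj that by (intro lin_indep_on_axis) (rule inj_on_subset)
    moreover have "B 1 *v u j 1 = axis (\<sigma> j) 1" if "j \<in> T" for j using B1 \<open>T \<subseteq> - K\<close> that by blast
    ultimately show ?thesis by (simp add: lin_indep_on_iff)
  qed
  have u0: "u i 0 = v0 i" for i by (simp add: u_def)
  obtain v1 where v1: "\<And>i. coords_in (rat {0, 1}) (v1 i)"
    and v1z: "\<And>i z. z \<in> {0, 1} \<Longrightarrow> v1 i z = u i z"
    and v1perp: "\<And>t i j. j \<in> nonnbrs E i \<Longrightarrow> i \<in> - K \<Longrightarrow> j \<in> - K \<Longrightarrow> v1 i t \<bullet> (B t *v v1 j t) = 0"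
  proof (rule extend_vertices[of "{0, 1}" B u E "{}" "- K"])
    show "u i z \<bullet> (B z *v u j z) = 0"
      if "z \<in> {0, 1}" "j \<in> nonnbrs E i" "i \<in> {} \<union> - K" "j \<in> {} \<union> - K" for z i j
    proof (cases "z = 0")
      case True
      then show ?thesis using perp0[OF that(2)] by (simp add: u0)
    next
      case False
      then have "z = 1" using that(1) by simp
      moreover have "i \<noteq> j" using that(2) by (auto simp: nonnbrs_def)
      then have "\<sigma> i \<noteq> \<sigma> j" using inj that(3,4) by (auto simp: inj_on_def)
      ultimately show ?thesis using B1[of j] that(4) by (simp add: u_def inner_axis_axis)
    qed
    show "lin_indep_on (\<lambda>j. B z *v u j z) (nonnbrs E i \<inter> ({} \<union> - K))" if "z \<in> {0, 1}" for z i
      using that ind1[of "nonnbrs E i \<inter> - K"] lin_indep_on_mono[OF ind0, of "nonnbrs E i \<inter> - K" i]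
      by (auto simp: u0)
  qed (use Brat Bsym u_rat in auto)
  have v10: "v1 i 0 = v0 i" for i using v1z[of 0 i] u0 by simp
  \<comment> \<open>From here on only time 0 is prescribed: nothing is known at time 1 about the
    conditions that involve vertices of \<open>K\<close>, so \<open>v2\<close> may have poles there.
    The vectors outside \<open>K\<close> are left as they are.\<close>
  obtain v2 where v2: "\<And>i. coords_in (rat {0}) (v2 i)"
    and v2K: "\<And>i. i \<in> - K \<Longrightarrow> v2 i = v1 i"
    and v2z: "\<And>i z. z \<in> {0} \<Longrightarrow> v2 i z = v1 i z"
    and v2perp: "\<And>t i j. j \<in> nonnbrs E i \<Longrightarrow> v2 i t \<bullet> (B t *v v2 j t) = 0"
  proof (rule extend_vertices[of "{0}" B v1 E "- K" K])
    show "coords_in (rat {0}) (v1 i)" for i by (rule rat_coords_mono[OF v1]) simp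
    show "v1 i z \<bullet> (B z *v v1 j z) = 0" if "z \<in> {0}" "j \<in> nonnbrs E i" for z i j
      using that perp0[of j i] by (simp add: v10)
    show "lin_indep_on (\<lambda>j. B z *v v1 j z) (nonnbrs E i \<inter> (- K \<union> K))" if "z \<in> {0}" for z i
      using that ind0[of i] by (simp add: v10)
  qed (use Brat Bsym v1perp in auto)
  have fact: "factored E R (B z) (\<lambda>i. v2 i z) (homog p)" if "z \<in> {0}" for z
    using that f0 v2z[of 0] by (simp add: v10 B_def)
  obtain q where q: "\<And>i. coords_in (rat {0}) (q i)" and qz: "\<And>i z. z \<in> {0} \<Longrightarrow> q i z = homog p i"
    and rows: "\<And>t k. k \<in> R \<Longrightarrow> (\<Sum>i\<in>UNIV. (v2 i t $ k) *\<^sub>R q i t) = 0"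
    and gen: "\<forall>\<^sub>F t in cofinite. stressed E (\<lambda>i. q i t) \<and> locally_spanning E (\<lambda>i. q i t)"
    by (rule stress_curve[of "{0}" B R v2 "\<lambda>i t. homog p i" E])
      (use Brat Bsym BR v2 v2perp fact loc in auto)
  obtain c where c: "coords_in (rat {0}) c" and "\<And>z. z \<in> {0} \<Longrightarrow> c z = (\<chi> i. fst (q i z))"
    and cF: "\<forall>\<^sub>F t in cofinite. Fstressable E (c t) \<and> (\<forall>K. spans (\<lambda>i. q i t) K \<longrightarrow> spans (homog (c t)) K)"
    by (rule normalise_curve[of "{0}" q E]) (use q gen qz in \<open>auto simp: homog_def\<close>)
  \<comment> \<open>The choice at time 1 pays off: \<open>v1\<close> is still rational there, so
    independence at that time spreads to almost all times, in particular to times where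
    \<open>c t\<close> is Fstressable. Gale duality then gives spanning on \<open>K\<close>.\<close>
  have "\<forall>\<^sub>F t in cofinite. lin_indep_on (\<lambda>j. B t *v v1 j t) (- K)"
    using ind1[of "- K"] by (intro rat_lin_indep_on[where Z = "{0, 1}" and z = 1])
      (auto intro: rat_matrix_vector_mult Brat v1 simp: v1z)
  with gen cF have "\<forall>\<^sub>F t in cofinite. Fstressable E (c t) \<and> spans (homog (c t)) K"
  proof eventually_elim
    case (elim t)
    have ind: "lin_indep_on (\<lambda>j. B t *v v2 j t) (- K)"
      using elim(3) by (simp add: lin_indep_on_iff v2K)
    have "spans (\<lambda>i. q i t) (- (- K))"
      by (rule lin_indep_on_imp_spans[of "B t" R "\<lambda>i. v2 i t"])
        (use Bsym BR rows ind elim(1) locally_spanning_imp_spans in auto)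
    then show ?case using elim(2) by simp
  qed
  then have "\<exists>t. Fstressable E (c t) \<and> spans (homog (c t)) K"
    by (rule eventually_happens'[rotated]) (simp add: infinite_UNIV_char_0)
  then show ?thesis using that by blast
qed

text \<open>The sets \<open>K\<close> are treated one at a time. A curve joins a framework that is
  good for the previous sets to one that is good for \<open>K\<close>; almost every point on it is
  good for all of them.\<close>

lemma Gstressable_exists:
  fixes p :: "real ^ 'd ^ 'n"
  assumes n: "CARD('n) \<ge> CARD('d) + 2" and p: "Fstressable E p"
  shows "\<exists>p' :: real ^ 'd ^ 'n. Gstressable E p'"
proof -
  have main: "\<exists>p' :: real ^ 'd ^ 'n. Fstressable E p' \<and> (\<forall>K\<in>\<K>. spans (homog p') K)"
    if "finite \<K>" "\<forall>K\<in>\<K>. card K = CARD('d) + 1" for \<K> :: "'n set set"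
    using that
  proof (induction \<K>)
    case empty
    then show ?case using p by auto
  next
    case (insert K \<K>)
    then obtain p1 :: "real ^ 'd ^ 'n" where p1: "Fstressable E p1" "\<forall>K\<in>\<K>. spans (homog p1) K" by auto
    obtain p2 :: "real ^ 'd ^ 'n" where p2: "Fstressable E p2" "spans (homog p2) K"
      using Fstressable_spanning_exists[OF n p, of K] insert.prems by auto
    obtain c where c: "coords_in (rat {0, 1}) c" "c 0 = p1" "c 1 = p2"
      "\<forall>\<^sub>F t in cofinite. Fstressable E (c t)"
      by (rule Fstressable_curve[OF n p1(1) p2(1)])
    have "\<forall>\<^sub>F t in cofinite. \<forall>K\<in>\<K>. spans (homog (c t)) K"
      using p1(2) c insert.hyps
      by (intro eventually_ball_finite) (auto intro: rat_spans_homog[where Z = "{0, 1}" and z = 0])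
    moreover have "\<forall>\<^sub>F t in cofinite. spans (homog (c t)) K"
      using p2(2) c by (intro rat_spans_homog[where Z = "{0, 1}" and z = 1]) auto
    ultimately have "\<forall>\<^sub>F t in cofinite. Fstressable E (c t) \<and> (\<forall>K\<in>insert K \<K>. spans (homog (c t)) K)"
      using c(4) by eventually_elim auto
    then have "\<exists>t. Fstressable E (c t) \<and> (\<forall>K\<in>insert K \<K>. spans (homog (c t)) K)"
      by (rule eventually_happens'[rotated]) (simp add: infinite_UNIV_char_0)
    then show ?case by blast
  qed
  have "\<exists>p' :: real ^ 'd ^ 'n. Fstressable E p' \<and> (\<forall>K\<in>{K. card K = CARD('d) + 1}. spans (homog p') K)"
    by (rule main) simp_all
  then obtain p' :: "real ^ 'd ^ 'n"
    where "Fstressable E p' \<and> (\<forall>K\<in>{K. card K = CARD('d) + 1}. spans (homog p') K)" by (elim exE)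
  then have "Gstressable E p'" by (simp add: Gstressable_iff[OF n])
  then show ?thesis ..
qed

text \<open>If two proper algebraic subsets covered the closure, minimality of the hull would give a
  point of \<open>S\<close> outside each of them. Polynomials vanishing on one subset but not at the
  corresponding point could then have no common nonzero in \<open>S\<close>.\<close>

lemma irreducible_setI:
  assumes "\<And>f g x y. real_polynomial_function f \<Longrightarrow> real_polynomial_function g \<Longrightarrow>
    x \<in> S \<Longrightarrow> y \<in> S \<Longrightarrow> f x \<noteq> 0 \<Longrightarrow> g y \<noteq> 0 \<Longrightarrow> \<exists>z\<in>S. f z \<noteq> 0 \<and> g z \<noteq> 0"
  shows "irreducible_set S"
  unfolding irreducible_set_def irreducible_algebraic_set_def zariski_closure_def
proof (intro notI, elim exE conjE)
  fix A B :: "'a set"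
  let ?H = "algebraic_set hull S"
  assume A: "algebraic_set A" and B: "algebraic_set B" and sub: "A \<subset> ?H" "B \<subset> ?H" and eq: "?H = A \<union> B"
  have "\<not> S \<subseteq> A" using hull_minimal[of S A algebraic_set] A sub by auto
  then obtain x where x: "x \<in> S" "x \<notin> A" by auto
  have "\<not> S \<subseteq> B" using hull_minimal[of S B algebraic_set] B sub by auto
  then obtain y where y: "y \<in> S" "y \<notin> B" by auto
  obtain f where f: "real_polynomial_function f" "f x \<noteq> 0" "\<And>z. z \<in> A \<Longrightarrow> f z = 0"
    using A x(2) unfolding algebraic_set_def by blast
  obtain g where g: "real_polynomial_function g" "g y \<noteq> 0" "\<And>z. z \<in> B \<Longrightarrow> g z = 0"
    using B y(2) unfolding algebraic_set_def by blast
  obtain z where "z \<in> S" "f z \<noteq> 0" "g z \<noteq> 0"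
    using assms[OF f(1) g(1) x(1) y(1) f(2) g(2)] by blast
  then show False using f(3) g(3) eq hull_subset[of S algebraic_set] by blast
qed

text \<open>Along a curve from \<open>x\<close> to \<open>y\<close>, both polynomials become
  rational functions of time, one nonzero at time 0 and the other at time 1, so both are nonzero at
  almost all times.\<close>

lemma Fstressable_irreducible:
  assumes n: "CARD('n) \<ge> CARD('d) + 2"
  shows "irreducible_set {p :: real ^ 'd ^ 'n. Fstressable E p}"
proof (rule irreducible_setI)
  fix f g :: "real ^ 'd ^ 'n \<Rightarrow> real" and x y
  assume fg: "real_polynomial_function f" "real_polynomial_function g"
    and xy: "x \<in> {p. Fstressable E p}" "y \<in> {p. Fstressable E p}" and nz: "f x \<noteq> 0" "g y \<noteq> 0"
  obtain c where c: "coords_in (rat {0, 1}) c" "c 0 = x" "c 1 = y"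
    "\<forall>\<^sub>F t in cofinite. Fstressable E (c t)"
    using Fstressable_curve[OF n, of E x y] xy by auto
  have "\<forall>\<^sub>F t in cofinite. f (c t) \<noteq> 0"
    by (rule rat_nonzero_cofinite[OF rat.polynomial[OF fg(1) c(1)], of 0]) (use c nz in auto)
  moreover have "\<forall>\<^sub>F t in cofinite. g (c t) \<noteq> 0"
    by (rule rat_nonzero_cofinite[OF rat.polynomial[OF fg(2) c(1)], of 1]) (use c nz in auto)
  ultimately have "\<forall>\<^sub>F t in cofinite. Fstressable E (c t) \<and> f (c t) \<noteq> 0 \<and> g (c t) \<noteq> 0"
    using c(4) by eventually_elim auto
  then have "\<exists>t. Fstressable E (c t) \<and> f (c t) \<noteq> 0 \<and> g (c t) \<noteq> 0"
    by (rule eventually_happens'[rotated]) (simp add: infinite_UNIV_char_0)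
  then show "\<exists>z\<in>{p. Fstressable E p}. f z \<noteq> 0 \<and> g z \<noteq> 0" by blast
qed

section \<open>Density and dimension\<close>

abbreviation polys :: "('x::euclidean_space \<Rightarrow> real) set" where
  "polys \<equiv> Collect real_polynomial_function"

interpretation polys: function_algebra polys
  by unfold_locales auto

lemma coords_in_polys_linear: "bounded_linear f \<Longrightarrow> coords_in polys f"
  by (auto simp: coords_in_def intro!: real_polynomial_function.intros(1) bounded_linear_inner_left_comp)

lemma coords_in_polys_id: "coords_in polys (\<lambda>x. x)"
  by (intro coords_in_polys_linear bounded_linear_ident)

lemma coords_in_polys_compose:
  assumes "coords_in polys f" "bounded_linear g"
  shows "coords_in polys (\<lambda>x. f (g x))"
  using assms real_polynomial_function_compose[of g] polynomial_function_bounded_linear[of g]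
  by (auto simp: coords_in_def o_def)

lemma polys_lin_indep_on:
  assumes "finite T" "\<And>j. j \<in> T \<Longrightarrow> coords_in polys (a j)"
  obtains D where "real_polynomial_function D" "\<forall>x. D x \<noteq> 0 \<longleftrightarrow> lin_indep_on (\<lambda>j. a j x) T"
proof (rule polys.gram_schmidt[of T a, OF assms(1)])
  show "coords_in polys (a j)" if "j \<in> T" for j by (rule assms(2)[OF that])
qed (use that in simp)

lemma polys_spans:
  fixes a :: "'i \<Rightarrow> 'x::euclidean_space \<Rightarrow> 'e::euclidean_space"
  assumes "finite S" "\<And>j. j \<in> S \<Longrightarrow> coords_in polys (a j)"
  obtains \<D> where "finite \<D>" "\<And>D. D \<in> \<D> \<Longrightarrow> real_polynomial_function D"
    "\<And>x. spans (\<lambda>j. a j x) S \<longleftrightarrow> (\<exists>D\<in>\<D>. D x \<noteq> 0)"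
proof -
  let ?\<T> = "{T. T \<subseteq> S \<and> card T = DIM('e)}"
  have "\<exists>D. real_polynomial_function D \<and> (\<forall>x. D x \<noteq> 0 \<longleftrightarrow> lin_indep_on (\<lambda>j. a j x) T)"
    if "T \<subseteq> S" for T
    by (rule polys_lin_indep_on[of T a]) (use that assms finite_subset in blast)+
  then obtain D where D: "\<And>T. T \<subseteq> S \<Longrightarrow> real_polynomial_function (D T)"
    "\<And>T x. T \<subseteq> S \<Longrightarrow> D T x \<noteq> 0 \<longleftrightarrow> lin_indep_on (\<lambda>j. a j x) T"
    by metis
  show ?thesis
  proof (rule that[of "D ` ?\<T>"])
    show "finite (D ` ?\<T>)" using assms(1) by simp
    show "spans (\<lambda>j. a j x) S \<longleftrightarrow> (\<exists>D\<in>D ` ?\<T>. D x \<noteq> 0)" for x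
    proof -
      have "spans (\<lambda>j. a j x) S \<longleftrightarrow> (\<exists>T\<in>?\<T>. lin_indep_on (\<lambda>j. a j x) T)"
        unfolding spans_iff_lin_indep_on using assms(1) by (auto dest: finite_subset)
      also have "\<dots> \<longleftrightarrow> (\<exists>T\<in>?\<T>. D T x \<noteq> 0)" using D(2) by (intro bex_cong) simp_all
      finally show ?thesis by simp
    qed
  qed (use D(1) in auto)
qed

lemma open_spans_homog: "open {p :: real ^ 'd ^ 'n. spans (homog p) K}"
proof -
  obtain \<D> where \<D>: "\<And>D. D \<in> \<D> \<Longrightarrow> real_polynomial_function D"
    and iff: "\<And>p :: real ^ 'd ^ 'n. spans (\<lambda>j. homog p j) K \<longleftrightarrow> (\<exists>D\<in>\<D>. D p \<noteq> 0)"
    by (rule polys_spans[of K "\<lambda>j p. homog p j"])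
      (auto intro: polys.coords_homog coords_in_polys_id)
  have "{p :: real ^ 'd ^ 'n. spans (homog p) K} = (\<Union>D\<in>\<D>. {p. D p \<noteq> 0})"
    using iff by auto
  moreover have "open {p. D p \<noteq> 0}" if "D \<in> \<D>" for D
  proof -
    have "continuous_on UNIV D"
      using \<D>[OF that] continuous_on_polymonial_function by (simp add: real_polynomial_function_eq)
    then show ?thesis by (intro open_Collect_neq continuous_on_const) auto
  qed
  ultimately show ?thesis by auto
qed

section \<open>Submanifolds and the dimension of dense open subsets\<close>

lemma Ck_on_subset: "Ck_on k S f \<Longrightarrow> T \<subseteq> S \<Longrightarrow> Ck_on k T f"
  by (induction k arbitrary: f) (auto intro: continuous_on_subset)

lemma smooth_submanifold_Int_open:
  fixes M :: "'a::euclidean_space set"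
  assumes "smooth_submanifold t M" "open W"
  shows "smooth_submanifold t (M \<inter> W)"
  unfolding smooth_submanifold_def
proof
  fix x assume x: "x \<in> M \<inter> W"
  then obtain U V f g L where "x \<in> U" and d: "diffeomorphism U V f g"
    and L: "subspace L" "dim L = t" and fUM: "f ` (U \<inter> M) = V \<inter> (L :: 'a set)"
    using assms(1) unfolding smooth_submanifold_def by blast
  have h: "homeomorphism U V f g" and oU: "open U" and oV: "open V"
    and sf: "smooth_on U f" and sg: "smooth_on V g"
    using d by (auto simp: diffeomorphism_def)
  have inv: "\<And>x. x \<in> U \<Longrightarrow> g (f x) = x" "\<And>y. y \<in> V \<Longrightarrow> f (g y) = y" "f ` U = V" "g ` V = U"
    using h by (auto simp: homeomorphism_def)
  let ?U = "U \<inter> W" and ?V = "V \<inter> g -` W"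
  have "open ?V"
    using h oV assms(2) by (intro continuous_open_preimage) (auto simp: homeomorphism_def)
  moreover have "f ` ?U = ?V" using inv by (force simp: image_iff)
  then have "homeomorphism ?U ?V f g" by (intro homeomorphism_of_subsets[OF h]) (auto simp: inv)
  ultimately have "diffeomorphism ?U ?V f g"
    using oU assms(2) sf sg unfolding diffeomorphism_def smooth_on_def
    by (auto intro: Ck_on_subset)
  moreover have "f ` (?U \<inter> (M \<inter> W)) = ?V \<inter> L"
  proof -
    have "f ` (?U \<inter> (M \<inter> W)) = f ` (U \<inter> M) \<inter> g -` W"
    proof (intro set_eqI iffI)
      fix y assume "y \<in> f ` (U \<inter> M) \<inter> g -` W"
      then obtain x where "y = f x" "x \<in> U" "x \<in> M" "g y \<in> W" by blast
      then show "y \<in> f ` (?U \<inter> (M \<inter> W))" using inv(1)[of x] by simp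
    qed (auto simp: inv(1))
    then show ?thesis unfolding fUM by auto
  qed
  ultimately show "\<exists>(U::'a set) (V::'a set) f g L. x \<in> U \<and> diffeomorphism U V f g \<and>
      subspace L \<and> dim L = t \<and> f ` (U \<inter> (M \<inter> W)) = V \<inter> L"
    using \<open>x \<in> U\<close> x L by (intro exI[of _ ?U] exI[of _ ?V] exI[of _ f] exI[of _ g] exI[of _ L]) auto
qed

text \<open>The same numbers \<open>t\<close> occur for both sets, so the two
  \<open>GREATEST\<close> expressions agree whatever their value. A nonempty relatively open piece
  of \<open>S\<close> meets \<open>W\<close> by density and is cut down to \<open>W\<close>; a
  relatively open piece of \<open>S \<inter> W\<close> is relatively open in
  \<open>S\<close>.\<close>

lemma semialgebraic_dim_dense_open:
  fixes S :: "'a::euclidean_space set"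
  assumes W: "open W" and dense: "S \<subseteq> closure (S \<inter> W)"
  shows "semialgebraic_dim S = semialgebraic_dim (S \<inter> W)"
proof -
  have "(\<exists>U. U \<noteq> {} \<and> openin (top_of_set S) U \<and> smooth_submanifold t U) \<longleftrightarrow>
    (\<exists>U. U \<noteq> {} \<and> openin (top_of_set (S \<inter> W)) U \<and> smooth_submanifold t U)" for t
  proof
    assume "\<exists>U. U \<noteq> {} \<and> openin (top_of_set S) U \<and> smooth_submanifold t U"
    then obtain U where U: "U \<noteq> {}" "openin (top_of_set S) U" "smooth_submanifold t U" by blast
    obtain T where T: "open T" "U = S \<inter> T" using U(2) by (auto simp: openin_open)
    have "T \<inter> closure (S \<inter> W) \<noteq> {}" using U(1) T dense by auto
    then have "T \<inter> (S \<inter> W) \<noteq> {}" using open_Int_closure_eq_empty[OF T(1)] by blast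
    then have "U \<inter> W \<noteq> {}" using T by auto
    moreover have "openin (top_of_set (S \<inter> W)) (U \<inter> W)" using T by (auto simp: openin_open)
    ultimately show "\<exists>U. U \<noteq> {} \<and> openin (top_of_set (S \<inter> W)) U \<and> smooth_submanifold t U"
      by (intro exI[of _ "U \<inter> W"] conjI smooth_submanifold_Int_open[OF U(3) W])
  next
    assume "\<exists>U. U \<noteq> {} \<and> openin (top_of_set (S \<inter> W)) U \<and> smooth_submanifold t U"
    then obtain U where U: "U \<noteq> {}" "openin (top_of_set (S \<inter> W)) U" "smooth_submanifold t U" by blast
    have "openin (top_of_set S) (S \<inter> W)" using W by (auto simp: openin_open)
    then have "openin (top_of_set S) U" using U(2) openin_trans by blast
    then show "\<exists>U. U \<noteq> {} \<and> openin (top_of_set S) U \<and> smooth_submanifold t U" using U by blast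
  qed
  moreover have "S = {} \<longleftrightarrow> S \<inter> W = {}" using dense by auto
  ultimately show ?thesis unfolding semialgebraic_dim_def by simp
qed

lemma eventually_cofinite_imp_at:
  fixes x :: "'a::t1_space"
  assumes "eventually P cofinite"
  shows "eventually P (at x)"
  unfolding eventually_at_topological
proof (intro exI conjI ballI impI)
  have "finite ({t. \<not> P t} - {x})" using assms by (simp add: eventually_cofinite)
  then show "open (- ({t. \<not> P t} - {x}))" by (intro open_Compl finite_imp_closed)
qed auto

text \<open>Join the given framework to some Gstressable one. The curve is Gstressable at almost all
  times and continuous at time 0, so its starting point is a limit of Gstressable
  frameworks.\<close>

lemma Fstressable_subset_closure:
  assumes n: "CARD('n) \<ge> CARD('d) + 2"
  shows "{p :: real ^ 'd ^ 'n. Fstressable E p} \<subseteq> closure {p. Gstressable E p}"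
proof
  fix x :: "real ^ 'd ^ 'n" assume "x \<in> {p. Fstressable E p}"
  then have x: "Fstressable E x" by simp
  obtain y :: "real ^ 'd ^ 'n" where y: "Gstressable E y" using Gstressable_exists[OF n x] by blast
  then have yF: "Fstressable E y" by (simp add: Gstressable_iff[OF n])
  obtain c where c: "coords_in (rat {0, 1}) c" "c 0 = x" "c 1 = y"
    "\<forall>\<^sub>F t in cofinite. Fstressable E (c t)"
    by (rule Fstressable_curve[OF n x yF])
  have "\<forall>\<^sub>F t in cofinite. \<forall>K\<in>{K. card K = CARD('d) + 1}. spans (homog (c t)) K"
  proof (intro eventually_ball_finite ballI)
    fix K :: "'n set" assume "K \<in> {K. card K = CARD('d) + 1}"
    then have "spans (homog (c 1)) K" using y by (simp add: c(3) Gstressable_iff[OF n])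
    then show "\<forall>\<^sub>F t in cofinite. spans (homog (c t)) K"
      by (intro rat_spans_homog[OF c(1)]) auto
  qed simp
  with c(4) have "\<forall>\<^sub>F t in cofinite. c t \<in> closure {p. Gstressable E p}"
  proof eventually_elim
    case (elim t)
    then have "Gstressable E (c t)" by (simp add: Gstressable_iff[OF n])
    then show ?case by (intro subsetD[OF closure_subset]) simp
  qed
  then have "\<forall>\<^sub>F t in at 0. c t \<in> closure {p. Gstressable E p}"
    by (rule eventually_cofinite_imp_at)
  moreover have "(c \<longlongrightarrow> c 0) (at 0)"
    using rat_coords_isCont[OF c(1), of 0] by (simp add: isCont_def)
  ultimately have "c 0 \<in> closure {p. Gstressable E p}"
    by (intro Lim_in_closed_set[of "closure {p. Gstressable E p}" c "at 0"]) auto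
  then show "x \<in> closure {p. Gstressable E p}" by (simp add: c(2))
qed

lemma semialgebraic_dim_Fstressable_eq:
  assumes n: "CARD('n) \<ge> CARD('d) + 2"
  shows "semialgebraic_dim {p :: real ^ 'd ^ 'n. Fstressable E p} = semialgebraic_dim {p :: real ^ 'd ^ 'n. Gstressable E p}"
proof -
  let ?W = "\<Inter>K\<in>{K. card K = CARD('d) + 1}. {p :: real ^ 'd ^ 'n. spans (homog p) K}"
  have "open ?W" by (intro open_INT ballI open_spans_homog) simp
  moreover have "{p :: real ^ 'd ^ 'n. Gstressable E p} = {p. Fstressable E p} \<inter> ?W"
    by (auto simp: Gstressable_iff[OF n])
  ultimately show ?thesis
    using semialgebraic_dim_dense_open[of ?W "{p. Fstressable E p}"] Fstressable_subset_closure[OF n, of E]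
    by simp
qed

section \<open>Constructibility\<close>

lemma algebraic_set_zeros: "real_polynomial_function f \<Longrightarrow> algebraic_set {x. f x = 0}"
  unfolding algebraic_set_def by (rule exI[of _ "{f}"]) auto

lemma algebraic_set_UNIV: "algebraic_set UNIV"
  unfolding algebraic_set_def by (rule exI[of _ "{}"]) auto

lemma algebraic_set_empty: "algebraic_set {}"
  using algebraic_set_zeros[OF real_polynomial_function.intros(2)[of 1]] by simp

lemma algebraic_set_Int:
  assumes "algebraic_set A" "algebraic_set B"
  shows "algebraic_set (A \<inter> B)"
proof -
  obtain F G where "finite F" "\<forall>f\<in>F. real_polynomial_function f" "A = {x. \<forall>f\<in>F. f x = 0}"
    "finite G" "\<forall>f\<in>G. real_polynomial_function f" "B = {x. \<forall>f\<in>G. f x = 0}"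
    using assms unfolding algebraic_set_def by (elim exE conjE)
  then show ?thesis unfolding algebraic_set_def by (intro exI[of _ "F \<union> G"]) auto
qed

lemma algebraic_set_Un:
  assumes "algebraic_set A" "algebraic_set B"
  shows "algebraic_set (A \<union> B)"
proof -
  obtain F G where FG: "finite F" "\<forall>f\<in>F. real_polynomial_function f" "A = {x. \<forall>f\<in>F. f x = 0}"
    "finite G" "\<forall>f\<in>G. real_polynomial_function f" "B = {x. \<forall>f\<in>G. f x = 0}"
    using assms unfolding algebraic_set_def by (elim exE conjE)
  let ?H = "(\<lambda>(f, g) x. f x * g x) ` (F \<times> G)"
  have "A \<union> B = {x. \<forall>h\<in>?H. h x = 0}" unfolding FG by auto
  moreover have "\<forall>h\<in>?H. real_polynomial_function h" using FG by auto
  ultimately show ?thesis unfolding algebraic_set_def using FG(1,4) by (intro exI[of _ ?H]) auto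
qed

lemma constructible_set_diff:
  assumes "algebraic_set A" "algebraic_set B"
  shows "constructible_set (A - B)"
  unfolding constructible_set_def quasi_projective_def
  by (rule exI[of _ "{A - B}"]) (use assms in auto)

lemma constructible_set_UN:
  assumes "finite I" "\<And>i. i \<in> I \<Longrightarrow> constructible_set (A i)"
  shows "constructible_set (\<Union>i\<in>I. A i)"
proof -
  have "\<forall>i\<in>I. \<exists>\<V>. finite \<V> \<and> (\<forall>V\<in>\<V>. quasi_projective V) \<and> A i = \<Union>\<V>"
    using assms(2) unfolding constructible_set_def by blast
  then obtain \<V> where "\<forall>i\<in>I. finite (\<V> i) \<and> (\<forall>V\<in>\<V> i. quasi_projective V) \<and> A i = \<Union>(\<V> i)"
    using bchoice[of I] by metis
  then show ?thesis
    unfolding constructible_set_def using assms(1) by (intro exI[of _ "\<Union>i\<in>I. \<V> i"]) auto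
qed

lemma quasi_projective_Int:
  assumes "quasi_projective V" "quasi_projective W"
  shows "quasi_projective (V \<inter> W)"
proof -
  obtain A B C D where "algebraic_set A" "algebraic_set B" "V = A - B"
    "algebraic_set C" "algebraic_set D" "W = C - D"
    using assms unfolding quasi_projective_def by (elim exE conjE)
  then show ?thesis
    unfolding quasi_projective_def
    by (intro exI[of _ "A \<inter> C"] exI[of _ "B \<union> D"]) (auto intro: algebraic_set_Int algebraic_set_Un)
qed

lemma constructible_set_Int:
  assumes "constructible_set S" "constructible_set T"
  shows "constructible_set (S \<inter> T)"
proof -
  obtain \<V> \<W> where "finite \<V>" "\<forall>V\<in>\<V>. quasi_projective V" "S = \<Union>\<V>"
    "finite \<W>" "\<forall>W\<in>\<W>. quasi_projective W" "T = \<Union>\<W>"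
    using assms unfolding constructible_set_def by (elim exE conjE)
  then show ?thesis
    unfolding constructible_set_def
    by (intro exI[of _ "(\<lambda>(V, W). V \<inter> W) ` (\<V> \<times> \<W>)"]) (auto intro: quasi_projective_Int)
qed

lemma constructible_set_algebraic: "algebraic_set A \<Longrightarrow> constructible_set A"
  using constructible_set_diff[OF _ algebraic_set_empty] by simp

lemma constructible_set_nonzero: "real_polynomial_function f \<Longrightarrow> constructible_set {x. f x \<noteq> 0}"
  using constructible_set_diff[OF algebraic_set_UNIV algebraic_set_zeros]
  by (simp add: set_diff_eq)

lemma constructible_set_INT:
  assumes "finite I" "\<And>i. i \<in> I \<Longrightarrow> constructible_set (A i)"
  shows "constructible_set (\<Inter>i\<in>I. A i)"
  using assms
  by (induction I) (auto intro: constructible_set_Int constructible_set_algebraic algebraic_set_UNIV)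

text \<open>Separates the variables, in preparation for eliminating a universal quantifier over
  \<open>y\<close>. Lists of pairs make sums concatenations and products lists of pairwise
  products.\<close>

lemma real_polynomial_function_prodE:
  fixes g :: "'x::euclidean_space \<times> 'y::euclidean_space \<Rightarrow> real"
  assumes "real_polynomial_function g"
  obtains ps where "\<forall>(\<alpha>, \<beta>)\<in>set ps. real_polynomial_function \<alpha>"
    "\<forall>x y. g (x, y) = (\<Sum>(\<alpha>, \<beta>)\<leftarrow>ps. \<alpha> x * \<beta> y)"
proof -
  have "\<exists>ps. (\<forall>(\<alpha>, \<beta> :: 'y \<Rightarrow> real)\<in>set ps. real_polynomial_function \<alpha>) \<and>
    (\<forall>x y. g (x, y) = (\<Sum>(\<alpha>, \<beta>)\<leftarrow>ps. \<alpha> x * \<beta> y))"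
    using assms
  proof induction
    case (linear f)
    have "bounded_linear (\<lambda>x. f (x, 0))"
      using bounded_linear_compose[OF linear bounded_linear_Pair[OF bounded_linear_ident bounded_linear_zero]] by simp
    moreover have "f (x, 0) + f (0, y) = f (x, y)" for x y
      using linear_add[OF bounded_linear.linear[OF linear], of "(x, 0)" "(0, y)"] by simp
    ultimately show ?case
      by (intro exI[of _ "[(\<lambda>x. f (x, 0), \<lambda>_. 1), (\<lambda>_. 1, \<lambda>y. f (0, y))]"])
        (simp add: real_polynomial_function.intros)
  next
    case (const c)
    show ?case by (intro exI[of _ "[(\<lambda>_. c, \<lambda>_. 1)]"]) auto
  next
    case (add f g)
    then obtain ps qs where "\<forall>(\<alpha>, \<beta> :: 'y \<Rightarrow> real)\<in>set ps. real_polynomial_function \<alpha>"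
      "\<forall>x y. f (x, y) = (\<Sum>(\<alpha>, \<beta>)\<leftarrow>ps. \<alpha> x * \<beta> y)"
      "\<forall>(\<alpha>, \<beta> :: 'y \<Rightarrow> real)\<in>set qs. real_polynomial_function \<alpha>"
      "\<forall>x y. g (x, y) = (\<Sum>(\<alpha>, \<beta>)\<leftarrow>qs. \<alpha> x * \<beta> y)"
      by (elim exE conjE)
    then show ?case by (intro exI[of _ "ps @ qs"]) auto
  next
    case (mult f g)
    then obtain ps qs where ps: "\<forall>(\<alpha>, \<beta> :: 'y \<Rightarrow> real)\<in>set ps. real_polynomial_function \<alpha>"
      "\<forall>x y. f (x, y) = (\<Sum>(\<alpha>, \<beta>)\<leftarrow>ps. \<alpha> x * \<beta> y)"
      and qs: "\<forall>(\<alpha>, \<beta> :: 'y \<Rightarrow> real)\<in>set qs. real_polynomial_function \<alpha>"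
      "\<forall>x y. g (x, y) = (\<Sum>(\<alpha>, \<beta>)\<leftarrow>qs. \<alpha> x * \<beta> y)"
      by (elim exE conjE)
    let ?m = "\<lambda>(\<alpha>, \<beta>) (\<alpha>', \<beta>'). ((\<lambda>x. \<alpha> x * \<alpha>' x) :: 'x \<Rightarrow> real, (\<lambda>y. \<beta> y * \<beta>' y) :: 'y \<Rightarrow> real)"
    have one: "(\<Sum>(\<alpha>', \<beta>')\<leftarrow>map (?m (\<alpha>, \<beta>)) rs. \<alpha>' x * \<beta>' y) = \<alpha> x * \<beta> y * (\<Sum>(\<alpha>', \<beta>')\<leftarrow>rs. \<alpha>' x * \<beta>' y)"
      for \<alpha> \<beta> rs x y
      by (induction rs) (auto simp: algebra_simps)
    have "(\<Sum>(\<alpha>, \<beta>)\<leftarrow>concat (map (\<lambda>ab. map (?m ab) qs) rs). \<alpha> x * \<beta> y) =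
        (\<Sum>(\<alpha>, \<beta>)\<leftarrow>rs. \<alpha> x * \<beta> y) * (\<Sum>(\<alpha>, \<beta>)\<leftarrow>qs. \<alpha> x * \<beta> y)" for rs x y
    proof (induction rs)
      case (Cons ab rs)
      obtain a b where "ab = (a, b)" by (cases ab)
      then show ?case using Cons by (simp add: one[where \<alpha> = a and \<beta> = b, simplified] distrib_right)
    qed simp
    moreover have "real_polynomial_function (fst (?m ab ab'))" if "ab \<in> set ps" "ab' \<in> set qs" for ab ab'
      using ps(1) qs(1) that by (auto simp: case_prod_beta)
    then have "\<forall>(\<alpha>, \<beta>)\<in>set (concat (map (\<lambda>ab. map (?m ab) qs) ps)). real_polynomial_function \<alpha>"
      by (auto simp: case_prod_beta)
    ultimately show ?case
      using ps(2) qs(2) by (intro exI[of _ "concat (map (\<lambda>ab. map (?m ab) qs) ps)"] conjI) simp_all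
  qed
  then show ?thesis using that by blast
qed

text \<open>Infinitely many equations, one for each \<open>y\<close>, reduce to finitely many by
  Gaussian elimination. If \<open>\<beta> m\<close> is nonzero at \<open>y0\<close>, the equation at
  \<open>y0\<close> is kept and used to cancel the last term in all others. The induction is over
  arbitrary \<open>\<beta>\<close> because cancelling changes these functions.\<close>

lemma algebraic_set_all_sum_eq_0:
  fixes \<alpha> :: "nat \<Rightarrow> 'x::euclidean_space \<Rightarrow> real" and \<beta> :: "nat \<Rightarrow> 'y \<Rightarrow> real"
  assumes "\<And>k. k < m \<Longrightarrow> real_polynomial_function (\<alpha> k)"
  shows "algebraic_set {x. \<forall>y. (\<Sum>k<m. \<alpha> k x * \<beta> k y) = 0}"
  using assms
proof (induction m arbitrary: \<beta>)
  case 0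
  then show ?case by (simp add: algebraic_set_UNIV)
next
  case (Suc m)
  show ?case
  proof (cases "\<forall>y. \<beta> m y = 0")
    case True
    then show ?thesis using Suc by simp
  next
    case False
    then obtain y0 where y0: "\<beta> m y0 \<noteq> 0" by blast
    define S where "S = (\<lambda>x y. \<Sum>k<Suc m. \<alpha> k x * \<beta> k y)"
    \<comment> \<open>The equation at \<open>y\<close> minus the multiple of the equation at
      \<open>y0\<close> for which the coefficient of \<open>\<alpha> m\<close> becomes zero.\<close>
    define T where "T = (\<lambda>x y. \<Sum>k<m. \<alpha> k x * (\<beta> k y - \<beta> m y / \<beta> m y0 * \<beta> k y0))"
    have "T x y = (\<Sum>k<Suc m. \<alpha> k x * (\<beta> k y - \<beta> m y / \<beta> m y0 * \<beta> k y0))" for x y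
      using y0 by (simp add: T_def)
    also have "(\<Sum>k<Suc m. \<alpha> k x * (\<beta> k y - \<beta> m y / \<beta> m y0 * \<beta> k y0)) =
        S x y - \<beta> m y / \<beta> m y0 * S x y0" for x y
      unfolding S_def sum_distrib_left sum_subtractf[symmetric] by (intro sum.cong) (auto simp: algebra_simps)
    finally have TS: "T x y = S x y - \<beta> m y / \<beta> m y0 * S x y0" for x y .
    have "{x. \<forall>y. S x y = 0} = {x. S x y0 = 0} \<inter> {x. \<forall>y. T x y = 0}"
    proof (intro set_eqI iffI)
      fix x assume "x \<in> {x. S x y0 = 0} \<inter> {x. \<forall>y. T x y = 0}"
      then have "S x y0 = 0" "T x y = 0" for y by auto
      then show "x \<in> {x. \<forall>y. S x y = 0}" using TS[of x] by simp
    qed (simp add: TS)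
    moreover have "algebraic_set {x. S x y0 = 0}"
      unfolding S_def
      by (intro algebraic_set_zeros real_polynomial_function_sum real_polynomial_function.intros(2,4)
          Suc.prems) auto
    moreover have "algebraic_set {x. \<forall>y. T x y = 0}"
      unfolding T_def using Suc.prems by (intro Suc.IH) auto
    ultimately show ?thesis using algebraic_set_Int by (simp add: S_def)
  qed
qed

lemma algebraic_set_all_eq_0:
  fixes g :: "'x::euclidean_space \<times> 'y::euclidean_space \<Rightarrow> real"
  assumes "real_polynomial_function g"
  shows "algebraic_set {x. \<forall>y. g (x, y) = 0}"
proof -
  obtain ps where ps: "\<forall>(\<alpha>, \<beta>)\<in>set ps. real_polynomial_function \<alpha>"
    and g: "\<forall>x y. g (x, y) = (\<Sum>(\<alpha>, \<beta>)\<leftarrow>ps. \<alpha> x * \<beta> y)"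
    by (rule real_polynomial_function_prodE[OF assms])
  have "g (x, y) = (\<Sum>k<length ps. fst (ps ! k) x * snd (ps ! k) y)" for x y
    unfolding g[rule_format] sum_list_sum_nth by (simp add: atLeast0LessThan case_prod_beta)
  moreover have "real_polynomial_function (fst (ps ! k))" if "k < length ps" for k
    using ps nth_mem[OF that] by (auto simp: case_prod_beta)
  ultimately show ?thesis
    using algebraic_set_all_sum_eq_0[of "length ps" "\<lambda>k. fst (ps ! k)" "\<lambda>k. snd (ps ! k)"] by simp
qed

text \<open>On the stratum where \<open>I\<close> indexes a maximal independent set of equations, the solutions \<open>w\<close>
  of the linear system are parametrized polynomially.\<close>

lemma constructible_set_linear_system:
  fixes a :: "'i \<Rightarrow> 'x::euclidean_space \<Rightarrow> 'w::euclidean_space"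
  assumes T: "finite T" "\<And>j. j \<in> T \<Longrightarrow> coords_in polys (a j)" and h: "real_polynomial_function h"
  shows "constructible_set {x. \<exists>w. (\<forall>j\<in>T. a j x \<bullet> w = 0) \<and> h (x, w) \<noteq> 0}"
proof -
  define stratum where "stratum = (\<lambda>I. {x. lin_indep_on (\<lambda>j. a j x) I} \<inter>
    (\<Inter>k\<in>T - I. {x. \<not> lin_indep_on (\<lambda>j. a j x) (insert k I)}))"
  have cover: "\<exists>I\<in>Pow T. x \<in> stratum I" for x
  proof -
    let ?\<I> = "{I. I \<subseteq> T \<and> lin_indep_on (\<lambda>j. a j x) I}"
    have "finite ?\<I>" using T(1) by simp
    moreover have "{} \<in> ?\<I>" by simp
    ultimately obtain I where I: "I \<in> ?\<I>" "\<forall>J\<in>?\<I>. I \<subseteq> J \<longrightarrow> I = J"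
      using finite_has_maximal[of ?\<I>] by blast
    have "\<not> lin_indep_on (\<lambda>j. a j x) (insert k I)" if "k \<in> T - I" for k
      using I that by blast
    then show ?thesis using I(1) by (auto simp: stratum_def)
  qed
  have "constructible_set (stratum I \<inter> {x. \<exists>w. (\<forall>j\<in>T. a j x \<bullet> w = 0) \<and> h (x, w) \<noteq> 0})"
    if I: "I \<subseteq> T" for I
  proof -
    have indep: "constructible_set {x. lin_indep_on (\<lambda>j. a j x) J}"
      "constructible_set {x. \<not> lin_indep_on (\<lambda>j. a j x) J}" if J: "J \<subseteq> T" for J
    proof -
      obtain D where D: "real_polynomial_function D" "\<forall>x. D x \<noteq> 0 \<longleftrightarrow> lin_indep_on (\<lambda>j. a j x) J"
        by (rule polys_lin_indep_on[of J a]) (use T J finite_subset in auto)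
      have 1: "{x. lin_indep_on (\<lambda>j. a j x) J} = {x. D x \<noteq> 0}" using D(2) by simp
      have 2: "{x. \<not> lin_indep_on (\<lambda>j. a j x) J} = {x. D x = 0}" using D(2) by auto
      show "constructible_set {x. lin_indep_on (\<lambda>j. a j x) J}"
        unfolding 1 by (rule constructible_set_nonzero[OF D(1)])
      show "constructible_set {x. \<not> lin_indep_on (\<lambda>j. a j x) J}"
        unfolding 2 by (intro constructible_set_algebraic algebraic_set_zeros D(1))
    qed
    have finI: "finite I" using I T(1) finite_subset by blast
    have aI: "coords_in polys (a j)" if "j \<in> I" for j using I T(2) that by blast
    have "\<exists>D G. (\<forall>y. coords_in polys y \<longrightarrow> coords_in polys (\<lambda>x. G x (y x))) \<and>
      (\<forall>x. D x \<noteq> 0 \<longleftrightarrow> lin_indep_on (\<lambda>j. a j x) I) \<and> (\<forall>x y. \<forall>j\<in>I. a j x \<bullet> G x y = 0) \<and>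
      (\<forall>x y. D x *\<^sub>R y - G x y \<in> span ((\<lambda>j. a j x) ` I)) \<and> (\<forall>x. linear (G x))"
      by (rule polys.gram_schmidt[of I a, OF finI], erule aI) (intro exI conjI, assumption+)
    then obtain D and G :: "'x \<Rightarrow> 'w \<Rightarrow> 'w"
      where G: "\<forall>y. coords_in polys y \<longrightarrow> coords_in polys (\<lambda>x. G x (y x))"
      and D: "\<forall>x. D x \<noteq> 0 \<longleftrightarrow> lin_indep_on (\<lambda>j. a j x) I"
      and perp: "\<forall>x y. \<forall>j\<in>I. a j x \<bullet> G x y = 0"
      and sp: "\<forall>x y. D x *\<^sub>R y - G x y \<in> span ((\<lambda>j. a j x) ` I)" and lin: "\<forall>x. linear (G x)"
      by (elim exE conjE)
    have "stratum I \<inter> {x. \<exists>w. (\<forall>j\<in>T. a j x \<bullet> w = 0) \<and> h (x, w) \<noteq> 0} =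
      stratum I \<inter> - {x. \<forall>y. h (x, G x y) = 0}" (is "?L = ?R")
    proof (intro set_eqI iffI)
      fix x assume "x \<in> ?L"
      then obtain w where x: "x \<in> stratum I" and w: "\<forall>j\<in>T. a j x \<bullet> w = 0" "h (x, w) \<noteq> 0" by auto
      \<comment> \<open>Every solution is a value of \<open>G x\<close>: as \<open>w\<close> is
        orthogonal to the independent equations, \<open>G x\<close> multiplies it by
        \<open>D x\<close>, which the factor \<open>1 / D x\<close> undoes.\<close>
      let ?y = "(1 / D x) *\<^sub>R w"
      let ?u = "D x *\<^sub>R ?y - G x ?y"
      have "orthogonal ?u ?u"
        by (rule orthogonal_to_span[OF sp[rule_format]])
          (use w I perp in \<open>auto simp: orthogonal_def inner_diff_left inner_commute[of w] inner_commute[of "G x _"]\<close>)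
      moreover have "D x \<noteq> 0" using x D by (auto simp: stratum_def)
      ultimately have "G x ?y = w" by (simp add: orthogonal_def)
      then have "h (x, G x ?y) \<noteq> 0" using w(2) by simp
      then show "x \<in> ?R" using x by blast
    next
      fix x assume "x \<in> ?R"
      then obtain y where x: "x \<in> stratum I" and y: "h (x, G x y) \<noteq> 0" by auto
      have "a k x \<bullet> G x y = 0" if k: "k \<in> T" for k
      proof (cases "k \<in> I")
        case False
        then have "a k x \<in> span ((\<lambda>j. a j x) ` I)"
          using x k by (auto simp: stratum_def lin_indep_on_insert)
        then have "orthogonal (G x y) (a k x)"
          by (rule orthogonal_to_span) (use perp in \<open>auto simp: orthogonal_def inner_commute[of "G x _"]\<close>)
        then show ?thesis by (simp add: orthogonal_def inner_commute)
      qed (use perp in blast)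
      then show "x \<in> ?L" using x y by auto
    qed
    moreover have "constructible_set (stratum I)"
      unfolding stratum_def using T(1) I
      by (intro constructible_set_Int constructible_set_INT indep) auto
    moreover have "constructible_set (- {x. \<forall>y. h (x, G x y) = 0})"
    proof -
      \<comment> \<open>What is known about \<open>G\<close> is polynomial dependence on
        \<open>x\<close> after inserting a polynomial function of \<open>x\<close> for
        \<open>y\<close>. Linearity in \<open>y\<close> makes it polynomial in the pair.\<close>
      have G_eq: "G (fst z) (snd z) = (\<Sum>b\<in>Basis. (snd z \<bullet> b) *\<^sub>R G (fst z) b)" for z
      proof -
        have "G (fst z) (snd z) = G (fst z) (\<Sum>b\<in>Basis. (snd z \<bullet> b) *\<^sub>R b)"
          by (simp add: euclidean_representation)
        then show ?thesis by (simp add: linear_sum[OF lin[rule_format]] linear_scale[OF lin[rule_format]])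
      qed
      have "coords_in polys (\<lambda>z :: 'x \<times> 'w. G (fst z) b)" for b
      proof -
        have "coords_in polys (\<lambda>x. G x b)" using G polys.coords_const by blast
        then show ?thesis by (rule coords_in_polys_compose) (rule bounded_linear_fst)
      qed
      moreover have "(\<lambda>z :: 'x \<times> 'w. snd z \<bullet> b) \<in> polys" for b
        by (rule polys.coords_inner_const[OF coords_in_polys_linear[OF bounded_linear_snd]])
      ultimately have "coords_in polys (\<lambda>z. G (fst z) (snd z))"
        unfolding G_eq by (intro polys.coords_sum polys.coords_scaleR)
      then have "coords_in polys (\<lambda>z. (fst z, G (fst z) (snd z)))"
        by (intro polys.coords_Pair coords_in_polys_linear[OF bounded_linear_fst])
      then have "(\<lambda>z. h (fst z, G (fst z) (snd z))) \<in> polys"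
        by (rule polys.polynomial[OF h])
      then have "algebraic_set {x. \<forall>y. h (x, G x y) = 0}"
        using algebraic_set_all_eq_0[of "\<lambda>z. h (fst z, G (fst z) (snd z))"] by simp
      then show ?thesis
        using constructible_set_diff[OF algebraic_set_UNIV] by (simp add: Compl_eq_Diff_UNIV)
    qed
    ultimately show ?thesis using constructible_set_Int by simp
  qed
  then have "constructible_set (\<Union>I\<in>Pow T. stratum I \<inter> {x. \<exists>w. (\<forall>j\<in>T. a j x \<bullet> w = 0) \<and> h (x, w) \<noteq> 0})"
    using T(1) by (intro constructible_set_UN) auto
  moreover have "(\<Union>I\<in>Pow T. stratum I \<inter> {x. \<exists>w. (\<forall>j\<in>T. a j x \<bullet> w = 0) \<and> h (x, w) \<noteq> 0}) =
      {x. \<exists>w. (\<forall>j\<in>T. a j x \<bullet> w = 0) \<and> h (x, w) \<noteq> 0}"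
    using cover by blast
  ultimately show ?thesis by simp
qed


section \<open>The conditions defining Fstressability are constructible\<close>

lemma constructible_set_spans:
  assumes "finite S" "\<And>j. j \<in> S \<Longrightarrow> coords_in polys (a j)"
  shows "constructible_set {x. spans (\<lambda>j. a j x) S}"
proof (rule polys_spans[OF assms(1), of a])
  fix \<D> assume D: "finite \<D>" "\<And>D. D \<in> \<D> \<Longrightarrow> real_polynomial_function D"
    "\<And>x. spans (\<lambda>j. a j x) S \<longleftrightarrow> (\<exists>D\<in>\<D>. D x \<noteq> 0)"
  have "{x. spans (\<lambda>j. a j x) S} = (\<Union>D\<in>\<D>. {x. D x \<noteq> 0})" using D(3) by auto
  also have "constructible_set \<dots>" using D(1,2) by (intro constructible_set_UN constructible_set_nonzero)
  finally show ?thesis .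
qed (rule assms(2))

lemma constructible_set_linear_system_spans:
  fixes a :: "'i \<Rightarrow> 'x::euclidean_space \<Rightarrow> 'w::euclidean_space"
  assumes T: "finite T" "\<And>j. j \<in> T \<Longrightarrow> coords_in polys (a j)"
    and S: "finite S" "\<And>j. j \<in> S \<Longrightarrow> coords_in polys (b j)"
  shows "constructible_set {x. \<exists>w. (\<forall>j\<in>T. a j x \<bullet> w = 0) \<and> spans (\<lambda>j. b j (x, w)) S}"
proof (rule polys_spans[OF S(1), of b])
  fix \<D> assume D: "finite \<D>" "\<And>D. D \<in> \<D> \<Longrightarrow> real_polynomial_function D"
    "\<And>z. spans (\<lambda>j. b j z) S \<longleftrightarrow> (\<exists>D\<in>\<D>. D z \<noteq> 0)"
  have "{x. \<exists>w. (\<forall>j\<in>T. a j x \<bullet> w = 0) \<and> spans (\<lambda>j. b j (x, w)) S} =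
      (\<Union>D\<in>\<D>. {x. \<exists>w. (\<forall>j\<in>T. a j x \<bullet> w = 0) \<and> D (x, w) \<noteq> 0})" using D(3) by auto
  also have "constructible_set \<dots>"
    using D(1,2) T by (intro constructible_set_UN constructible_set_linear_system)
  finally show ?thesis .
qed (rule S(2))

text \<open>The stress matrix is the unknown of a linear system whose coefficients are polynomials
  in \<open>p\<close>, and by \<open>kernel_le_vals_iff\<close> maximality of the rank is a spanning
  condition on the pair.\<close>

lemma constructible_set_stressed: "constructible_set {p :: real ^ 'd ^ 'n. stressed E (homog p)}"
proof -
  let ?C = "Basis :: ((real ^ 'd) \<times> real) set"
  \<comment> \<open>Three kinds of equations, each written as an inner product with
    \<open>\<Omega>\<close>: symmetry, the zero entries at nonedges, and equilibrium at the vertex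
    \<open>i\<close> tested against the basis vector \<open>c\<close>.\<close>
  define a :: "'n \<times> 'n + 'n \<times> 'n + 'n \<times> (real ^ 'd) \<times> real \<Rightarrow> real ^ 'd ^ 'n \<Rightarrow> real ^ 'n ^ 'n"
    where "a = case_sum (\<lambda>(i, j) p. axis i (axis j 1) - axis j (axis i 1))
      (case_sum (\<lambda>(i, j) p. axis i (axis j 1)) (\<lambda>(i, c) p. axis i (vals (homog p) c)))"
  define T where "T = (UNIV :: ('n \<times> 'n) set) <+> ({(i, j). j \<in> nonnbrs E i} <+> (UNIV :: 'n set) \<times> ?C)"
  define b where "b = (\<lambda>j (z :: (real ^ 'd ^ 'n) \<times> (real ^ 'n ^ 'n)). stress_system (snd z) (homog (fst z)) j)"
  have vals_poly: "coords_in polys (\<lambda>x. vals (homog (f x)) c)" if "coords_in polys f" for f :: "'x::euclidean_space \<Rightarrow> real ^ 'd ^ 'n" and c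
    by (rule polys.coords_vecI)
      (simp only: vals_nth polys.coords_real_iff, intro polys.coords_inner_const polys.coords_homog that)
  have aT: "coords_in polys (a j)" for j
  proof -
    have "coords_in polys (\<lambda>p :: real ^ 'd ^ 'n. axis i (vals (homog p) c) :: real ^ 'n ^ 'n)" for i c
    proof (rule polys.coords_vecI)
      fix k
      show "coords_in polys (\<lambda>p :: real ^ 'd ^ 'n. axis i (vals (homog p) c) $ k :: real ^ 'n)"
        using vals_poly[OF coords_in_polys_id] by (cases "k = i") (auto simp: axis_def intro: polys.coords_const)
    qed
    then show ?thesis
      unfolding a_def by (auto split: sum.split prod.split intro: polys.coords_const)
  qed
  have bS: "coords_in polys (b j)" for j
  proof (cases j)
    case (Inl i)
    then show ?thesis
      using polys.coords_vec_nth[OF coords_in_polys_linear[OF bounded_linear_snd]]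
      by (simp add: b_def stress_system_def)
  next
    case (Inr c)
    then show ?thesis
      using vals_poly[OF coords_in_polys_linear[OF bounded_linear_fst]]
      by (simp add: b_def stress_system_def)
  qed
  have T_iff: "(\<forall>j\<in>T. a j p \<bullet> \<Omega> = 0) \<longleftrightarrow>
      transpose \<Omega> = \<Omega> \<and> (\<forall>i. \<forall>j\<in>nonnbrs E i. \<Omega> $ i $ j = 0) \<and> (\<forall>z. \<Omega> *v vals (homog p) z = 0)" for p \<Omega>
  proof -
    have "(\<forall>j\<in>T. a j p \<bullet> \<Omega> = 0) \<longleftrightarrow> (\<forall>i j. \<Omega> $ i $ j = \<Omega> $ j $ i) \<and>
        (\<forall>i. \<forall>j\<in>nonnbrs E i. \<Omega> $ i $ j = 0) \<and> (\<forall>i. \<forall>c\<in>?C. vals (homog p) c \<bullet> \<Omega> $ i = 0)"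
      unfolding T_def a_def Plus_def ball_Un ball_simps
      by (simp add: inner_diff_left inner_axis' Ball_def split_paired_All)
    also have "(\<forall>i j. \<Omega> $ i $ j = \<Omega> $ j $ i) \<longleftrightarrow> transpose \<Omega> = \<Omega>"
      by (auto simp: transpose_def vec_eq_iff)
    also have "(\<forall>i. \<forall>c\<in>?C. vals (homog p) c \<bullet> \<Omega> $ i = 0) \<longleftrightarrow> (\<forall>z. \<Omega> *v vals (homog p) z = 0)"
      unfolding stress_vals_iff[symmetric] inner_commute[of "vals _ _"] inner_vals euclidean_all_zero_iff ..
    finally show ?thesis .
  qed
  have "{p :: real ^ 'd ^ 'n. stressed E (homog p)} =
      {p. \<exists>\<Omega>. (\<forall>j\<in>T. a j p \<bullet> \<Omega> = 0) \<and> spans (\<lambda>j. b j (p, \<Omega>)) (UNIV <+> ?C)}"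
  proof (intro Collect_cong)
    fix p :: "real ^ 'd ^ 'n"
    have "(\<forall>z. \<Omega> *v vals (homog p) z = 0) \<Longrightarrow>
        (\<forall>x. \<Omega> *v x = 0 \<longrightarrow> x \<in> range (vals (homog p))) \<longleftrightarrow> spans (\<lambda>j. b j (p, \<Omega>)) (UNIV <+> ?C)" for \<Omega>
      unfolding b_def fst_conv snd_conv by (rule kernel_le_vals_iff) blast
    then show "stressed E (homog p) \<longleftrightarrow>
        (\<exists>\<Omega>. (\<forall>j\<in>T. a j p \<bullet> \<Omega> = 0) \<and> spans (\<lambda>j. b j (p, \<Omega>)) (UNIV <+> ?C))"
      unfolding stressed_def T_iff by blast
  qed
  also have "constructible_set \<dots>"
    by (rule constructible_set_linear_system_spans) (auto simp: aT bS T_def)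
  finally show ?thesis .
qed

lemma constructible_set_Fstressable: "constructible_set {p :: real ^ 'd ^ 'n. Fstressable E p}"
proof -
  have "{p :: real ^ 'd ^ 'n. Fstressable E p} =
      {p. stressed E (homog p)} \<inter> (\<Inter>i. {p. spans (\<lambda>j. homog p j) (- nonnbrs E i)})"
    by (auto simp: Fstressable_iff locally_spanning_def)
  also have "constructible_set \<dots>"
    by (intro constructible_set_Int constructible_set_stressed constructible_set_INT
        constructible_set_spans polys.coords_homog coords_in_polys_id) simp_all
  finally show ?thesis .
qed

theorem theorem6p3:
  fixes E :: "'n::finite set set"
  assumes "simple_graph E"
    and "CARD('n) \<ge> CARD('d::finite) + 2"
  shows "constructible_set {p :: real ^ 'd ^ 'n. Fstressable E p} \<and>
         irreducible_set {p :: real ^ 'd ^ 'n. Fstressable E p} \<and>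
         semialgebraic_dim {p :: real ^ 'd ^ 'n. Fstressable E p} =
           semialgebraic_dim {p :: real ^ 'd ^ 'n. Gstressable E p}"
  using constructible_set_Fstressable Fstressable_irreducible[OF assms(2)]
    semialgebraic_dim_Fstressable_eq[OF assms(2)] by blast

end
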